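(* Let $(P_t)_{t\ge0}$ be a symmetric Markov semigroup with reversible probability measure $\mu$ and generator $L$. Assume that $L$ satisfies a Poincaré inequality and that there is a decomposition into orthogonal spaces $L^2(\mu)=\bigoplus_{k\ge0}\mathcal{H}_k$, where $\mathcal{H}_0$ is the space of constant functions and each $\mathcal{H}_k$ is a linear space, with the property that, for some real numbers $a>0$, $C>0$ and $p>\frac12$, for all $k\ge1$, all $f\in\mathcal{H}_k$ and all $t>0$, $$\|P_tf\|_\infty\le C\,k^p\,e^{-atk^2}\,\|f\|_2 .$$ Then $L$ satisfies a tight Sobolev inequality with dimension $m=2p+1$.
   Context: Norms are those of $L^q(\mu)$. $\mathcal{E}(f,f)=-\int fLf\,d\mu$ denotes the Dirichlet form of $L$ (equal to $\int\Gamma(f,f)\,d\mu$ where $\Gamma$ is the carré du champ of $L$), extended to its domain $\mathcal{D}(\mathcal{E})$. $L$ satisfies a Poincaré inequality if for some constant $C'$, $\int f^2d\mu-(\int f\,d\mu)^2\le C'\mathcal{E}(f,f)$ for all $f\in\mathcal{D}(\mathcal{E})$. For $m>2$, $L$ satisfies a tight Sobolev inequality with dimension $m$ if there is a constant $C''$ such that for all $f\in\mathcal{D}(\mathcal{E})$, $$\|f\|_{2m/(m-2)}^2\le\|f\|_2^2+C''\,\mathcal{E}(f,f).$$ *)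

theory Defs
  imports "HOL-Probability.Probability" "HOL-Probability.Essential_Supremum"
begin

text \<open>
  Elements of the Lebesgue spaces are represented by real-valued measurable functions; identities
  between them are understood almost everywhere.
\<close>

definition Lp_space :: "'a measure \<Rightarrow> real \<Rightarrow> ('a \<Rightarrow> real) set" where
  "Lp_space M q = {f \<in> borel_measurable M. integrable M (\<lambda>x. \<bar>f x\<bar> powr q)}"

text \<open>
  The following is the norm of \<open>f\<close> only if \<open>f \<in> Lp_space M q\<close>; otherwise the norm is infinite, while
  the Bochner integral below defaults to \<open>0\<close>.
\<close>

definition Lp_norm :: "'a measure \<Rightarrow> real \<Rightarrow> ('a \<Rightarrow> real) \<Rightarrow> real" where
  "Lp_norm M q f = (\<integral>x. \<bar>f x\<bar> powr q \<partial>M) powr (1 / q)"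

definition Linf_norm :: "'a measure \<Rightarrow> ('a \<Rightarrow> real) \<Rightarrow> ereal" where
  "Linf_norm M f = esssup M (\<lambda>x. ereal \<bar>f x\<bar>)"

abbreviation L2 :: "'a measure \<Rightarrow> ('a \<Rightarrow> real) set" where
  "L2 M \<equiv> Lp_space M 2"

text \<open>
  The operators act on \<open>L2 M\<close>. That they are well defined on classes modulo equality almost
  everywhere, leave \<open>M\<close> invariant and are contractions follows from the axioms.
\<close>

locale symmetric_Markov_semigroup = prob_space M for M :: "'a measure" +
  fixes P :: "real \<Rightarrow> ('a \<Rightarrow> real) \<Rightarrow> 'a \<Rightarrow> real"
  assumes P_L2: "\<And>t f. 0 \<le> t \<Longrightarrow> f \<in> L2 M \<Longrightarrow> P t f \<in> L2 M"
    and P_add: "\<And>t f g. 0 \<le> t \<Longrightarrow> f \<in> L2 M \<Longrightarrow> g \<in> L2 M \<Longrightarrow>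
      AE x in M. P t (\<lambda>y. f y + g y) x = P t f x + P t g x"
    and P_scale: "\<And>t c f. 0 \<le> t \<Longrightarrow> f \<in> L2 M \<Longrightarrow> AE x in M. P t (\<lambda>y. c * f y) x = c * P t f x"
    and P_nonneg: "\<And>t f. 0 \<le> t \<Longrightarrow> f \<in> L2 M \<Longrightarrow> (AE x in M. 0 \<le> f x) \<Longrightarrow> AE x in M. 0 \<le> P t f x"
    and P_one: "\<And>t. 0 \<le> t \<Longrightarrow> AE x in M. P t (\<lambda>_. 1) x = 1"
    and P_zero: "\<And>f. f \<in> L2 M \<Longrightarrow> AE x in M. P 0 f x = f x"
    and P_semigroup: "\<And>s t f. 0 \<le> s \<Longrightarrow> 0 \<le> t \<Longrightarrow> f \<in> L2 M \<Longrightarrow>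
      AE x in M. P s (P t f) x = P (s + t) f x"
    and P_symmetric: "\<And>t f g. 0 \<le> t \<Longrightarrow> f \<in> L2 M \<Longrightarrow> g \<in> L2 M \<Longrightarrow>
      (\<integral>x. f x * P t g x \<partial>M) = (\<integral>x. P t f x * g x \<partial>M)"
    and P_continuous: "\<And>f. f \<in> L2 M \<Longrightarrow>
      ((\<lambda>t. Lp_norm M 2 (\<lambda>x. P t f x - f x)) \<longlongrightarrow> 0) (at_right 0)"

definition is_generator_value ::
    "'a measure \<Rightarrow> (real \<Rightarrow> ('a \<Rightarrow> real) \<Rightarrow> 'a \<Rightarrow> real) \<Rightarrow> ('a \<Rightarrow> real) \<Rightarrow> ('a \<Rightarrow> real) \<Rightarrow> bool" where
  "is_generator_value M P f g \<longleftrightarrow> g \<in> L2 M \<and>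
     ((\<lambda>t. Lp_norm M 2 (\<lambda>x. (P t f x - f x) / t - g x)) \<longlongrightarrow> 0) (at_right 0)"

definition generator_domain ::
    "'a measure \<Rightarrow> (real \<Rightarrow> ('a \<Rightarrow> real) \<Rightarrow> 'a \<Rightarrow> real) \<Rightarrow> ('a \<Rightarrow> real) set" where
  "generator_domain M P = {f \<in> L2 M. \<exists>g. is_generator_value M P f g}"

text \<open>The value is determined only almost everywhere, hence the choice of a representative.\<close>

definition generator ::
    "'a measure \<Rightarrow> (real \<Rightarrow> ('a \<Rightarrow> real) \<Rightarrow> 'a \<Rightarrow> real) \<Rightarrow> ('a \<Rightarrow> real) \<Rightarrow> 'a \<Rightarrow> real" where
  "generator M P f = (SOME g. is_generator_value M P f g)"

definition generator_form ::
    "'a measure \<Rightarrow> (real \<Rightarrow> ('a \<Rightarrow> real) \<Rightarrow> 'a \<Rightarrow> real) \<Rightarrow> ('a \<Rightarrow> real) \<Rightarrow> real" where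
  "generator_form M P f = - (\<integral>x. f x * generator M P f x \<partial>M)"

text \<open>
  The Dirichlet form is the closure of \<open>generator_form\<close>: its domain consists of the \<open>L2\<close>-limits of
  sequences in the domain of the generator that are Cauchy for the form. The limit of the form
  along such a sequence does not depend on the sequence, since the form is closable.
\<close>

definition form_approximates ::
    "'a measure \<Rightarrow> (real \<Rightarrow> ('a \<Rightarrow> real) \<Rightarrow> 'a \<Rightarrow> real) \<Rightarrow> (nat \<Rightarrow> 'a \<Rightarrow> real) \<Rightarrow> ('a \<Rightarrow> real) \<Rightarrow> bool" where
  "form_approximates M P u f \<longleftrightarrow>
     (\<forall>n. u n \<in> generator_domain M P) \<and>
     (\<lambda>n. Lp_norm M 2 (\<lambda>x. u n x - f x)) \<longlonglongrightarrow> 0 \<and>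
     (\<forall>e>0. \<exists>N. \<forall>m\<ge>N. \<forall>n\<ge>N. generator_form M P (\<lambda>x. u m x - u n x) < e)"

definition Dirichlet_domain ::
    "'a measure \<Rightarrow> (real \<Rightarrow> ('a \<Rightarrow> real) \<Rightarrow> 'a \<Rightarrow> real) \<Rightarrow> ('a \<Rightarrow> real) set" where
  "Dirichlet_domain M P = {f \<in> L2 M. \<exists>u. form_approximates M P u f}"

definition Dirichlet_form ::
    "'a measure \<Rightarrow> (real \<Rightarrow> ('a \<Rightarrow> real) \<Rightarrow> 'a \<Rightarrow> real) \<Rightarrow> ('a \<Rightarrow> real) \<Rightarrow> real" where
  "Dirichlet_form M P f =
     (THE e. \<exists>u. form_approximates M P u f \<and> (\<lambda>n. generator_form M P (u n)) \<longlonglongrightarrow> e)"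

definition Poincare_inequality ::
    "'a measure \<Rightarrow> (real \<Rightarrow> ('a \<Rightarrow> real) \<Rightarrow> 'a \<Rightarrow> real) \<Rightarrow> bool" where
  "Poincare_inequality M P \<longleftrightarrow> (\<exists>C. \<forall>f\<in>Dirichlet_domain M P.
     (\<integral>x. (f x)\<^sup>2 \<partial>M) - (\<integral>x. f x \<partial>M)\<^sup>2 \<le> C * Dirichlet_form M P f)"

text \<open>The membership in \<open>Lp_space\<close> says that the norm on the left-hand side is finite.\<close>

definition tight_Sobolev_inequality ::
    "'a measure \<Rightarrow> (real \<Rightarrow> ('a \<Rightarrow> real) \<Rightarrow> 'a \<Rightarrow> real) \<Rightarrow> real \<Rightarrow> bool" where
  "tight_Sobolev_inequality M P m \<longleftrightarrow> (\<exists>C. \<forall>f\<in>Dirichlet_domain M P.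
     f \<in> Lp_space M (2 * m / (m - 2)) \<and>
     (Lp_norm M (2 * m / (m - 2)) f)\<^sup>2 \<le> (Lp_norm M 2 f)\<^sup>2 + C * Dirichlet_form M P f)"

definition L2_subspace :: "'a measure \<Rightarrow> ('a \<Rightarrow> real) set \<Rightarrow> bool" where
  "L2_subspace M V \<longleftrightarrow> V \<subseteq> L2 M \<and> (\<lambda>_. 0) \<in> V \<and>
     (\<forall>f\<in>V. \<forall>g\<in>V. (\<lambda>x. f x + g x) \<in> V) \<and> (\<forall>c. \<forall>f\<in>V. (\<lambda>x. c * f x) \<in> V)"

text \<open>
  The direct sum is the Hilbert space one: every element is the \<open>L2\<close>-sum of a series of components
  (whose uniqueness follows from orthogonality).
\<close>

definition orthogonal_decomposition :: "'a measure \<Rightarrow> (nat \<Rightarrow> ('a \<Rightarrow> real) set) \<Rightarrow> bool" where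
  "orthogonal_decomposition M H \<longleftrightarrow>
     (\<forall>k. L2_subspace M (H k)) \<and>
     (\<forall>j k. j \<noteq> k \<longrightarrow> (\<forall>f\<in>H j. \<forall>g\<in>H k. (\<integral>x. f x * g x \<partial>M) = 0)) \<and>
     (\<forall>f\<in>L2 M. \<exists>h. (\<forall>k. h k \<in> H k) \<and>
        (\<lambda>n. Lp_norm M 2 (\<lambda>x. f x - (\<Sum>k<n. h k x))) \<longlonglongrightarrow> 0)"

definition constant_functions :: "'a measure \<Rightarrow> ('a \<Rightarrow> real) set" where
  "constant_functions M = {f \<in> L2 M. \<exists>c. AE x in M. f x = c}"

end

theory Submission
  imports Defs
begin

text \<open>
  Testing \<open>P t g\<close> against the partial sums of its own decomposition gives the ultracontractive
  bound \<open>\<parallel>P t g\<parallel>\<^sub>2\<^sup>2 \<le> K t\<^bsup>-m/2\<^esup> \<parallel>g\<parallel>\<^sub>1\<^sup>2\<close> for \<open>t \<le> 1\<close> and \<open>m = 2p + 1\<close>, because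
  \<open>\<Sum>k. k\<^bsup>2p\<^esup> e\<^bsup>-2atk\<^sup>2\<^esup>\<close> is of order \<open>t\<^bsup>-p-1/2\<^esup>\<close>. With the forms \<open>\<E>\<^sub>t(g,g) = \<langle>g - P t g, g\<rangle> / t\<close>, which
  only need \<open>g \<in> L\<^sup>2\<close> and decrease along multiples of \<open>t\<close>, this is a Nash inequality. The dyadic
  layers \<open>l\<^sub>k = min (max (\<bar>g\<bar> - 2\<^sup>k) 0) 2\<^sup>k\<close> satisfy \<open>\<Sum>k. \<E>\<^sub>t(l\<^sub>k,l\<^sub>k) \<le> \<E>\<^sub>t(g,g)\<close> by positivity of the semigroup, and
  the Nash inequality applied to each layer bounds \<open>\<Sum>k. 2\<^bsup>qk\<^esup> \<mu>(\<bar>g\<bar> \<ge> 2\<^sup>k)\<close> for \<open>q = 2m/(m-2)\<close>. This yields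
  \<open>\<parallel>g\<parallel>\<^sub>q\<^sup>2 \<le> A (\<parallel>g\<parallel>\<^sub>2\<^sup>2 + \<E>(g,g))\<close>. For centred \<open>g\<close> the Poincare inequality absorbs \<open>\<parallel>g\<parallel>\<^sub>2\<^sup>2\<close>, and
  \<open>\<parallel>c + g\<parallel>\<^sub>q\<^sup>2 \<le> c\<^sup>2 + k \<parallel>g\<parallel>\<^sub>q\<^sup>2\<close> makes the inequality tight. Fatou's lemma extends it from the domain of
  the generator to the domain of the Dirichlet form.
\<close>

text \<open>Evaluate at the minimiser \<open>s = X / B\<close>. For \<open>B = 0\<close> the
  expression is affine in \<open>s\<close> and takes the value -1 at the chosen point unless
  \<open>X = 0\<close>. This gives Cauchy-Schwarz both for the inner product and for the
  approximating forms.\<close>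

lemma quadratic_nonneg_imp_discrim_le:
  fixes A B X :: real
  assumes "\<And>s. 0 \<le> A - 2 * s * X + s\<^sup>2 * B" and "0 \<le> B"
  shows "X\<^sup>2 \<le> A * B"
proof (cases "B = 0")
  case True
  have "X = 0"
  proof (rule ccontr)
    assume "X \<noteq> 0"
    then show False
      using assms(1)[of "(A + 1) / (2 * X)"] True by simp
  qed
  with True show ?thesis by simp
next
  case False
  then have "B > 0" using assms(2) by simp
  then show ?thesis
    using assms(1)[of "X / B"] by (simp add: field_simps power2_eq_square)
qed

subsection \<open>The inner product of square-integrable functions\<close>

definition L2_inner :: "'a measure \<Rightarrow> ('a \<Rightarrow> real) \<Rightarrow> ('a \<Rightarrow> real) \<Rightarrow> real" where
  "L2_inner M f g = (\<integral>x. f x * g x \<partial>M)"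

lemma L2_iff: "f \<in> L2 M \<longleftrightarrow> f \<in> borel_measurable M \<and> integrable M (\<lambda>x. (f x)\<^sup>2)"
  by (simp add: Lp_space_def)

lemma L2_measurable [measurable_dest]: "f \<in> L2 M \<Longrightarrow> f \<in> borel_measurable M"
  by (simp add: L2_iff)

lemma Lp_norm_2: "Lp_norm M 2 f = sqrt (L2_inner M f f)"
  by (simp add: Lp_norm_def L2_inner_def powr_half_sqrt power2_eq_square)

lemma L2_inner_self_nonneg: "0 \<le> L2_inner M f f"
  by (simp add: L2_inner_def)

lemma L2_inner_commute: "L2_inner M f g = L2_inner M g f"
  by (simp add: L2_inner_def mult.commute)

lemma L2_mult_integrable:
  assumes "f \<in> L2 M" "g \<in> L2 M"
  shows "integrable M (\<lambda>x. f x * g x)"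
proof (rule Bochner_Integration.integrable_bound)
  show "integrable M (\<lambda>x. (f x)\<^sup>2 + (g x)\<^sup>2)"
    using assms by (simp add: L2_iff)
  show "(\<lambda>x. f x * g x) \<in> borel_measurable M"
    using assms by (auto dest: L2_measurable)
  have "\<bar>a * b\<bar> \<le> a\<^sup>2 + b\<^sup>2" for a b :: real
    using sum_squares_bound[of "\<bar>a\<bar>" "\<bar>b\<bar>"] mult_nonneg_nonneg[of "\<bar>a\<bar>" "\<bar>b\<bar>"]
    unfolding abs_mult power2_abs by linarith
  then show "AE x in M. norm (f x * g x) \<le> norm ((f x)\<^sup>2 + (g x)\<^sup>2)"
    by simp
qed

lemma L2_AE_bound:
  assumes "f \<in> L2 M" "g \<in> borel_measurable M" "AE x in M. \<bar>g x\<bar> \<le> \<bar>f x\<bar>"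
  shows "g \<in> L2 M"
proof -
  have "integrable M (\<lambda>x. (g x)\<^sup>2)"
  proof (rule Bochner_Integration.integrable_bound)
    show "integrable M (\<lambda>x. (f x)\<^sup>2)" using assms by (simp add: L2_iff)
    show "(\<lambda>x. (g x)\<^sup>2) \<in> borel_measurable M" using assms(2) by measurable
    show "AE x in M. norm ((g x)\<^sup>2) \<le> norm ((f x)\<^sup>2)"
      using assms(3) by eventually_elim (simp add: abs_le_square_iff)
  qed
  then show ?thesis using assms by (simp add: L2_iff)
qed

lemma L2_scale [intro]: "f \<in> L2 M \<Longrightarrow> (\<lambda>x. c * f x) \<in> L2 M"
  by (auto simp: L2_iff power_mult_distrib)

lemma L2_add [intro]:
  assumes "f \<in> L2 M" "g \<in> L2 M"
  shows "(\<lambda>x. f x + g x) \<in> L2 M"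
  using assms L2_mult_integrable[OF assms] by (auto simp: L2_iff power2_sum mult.assoc)

lemma L2_diff [intro]:
  assumes "f \<in> L2 M" "g \<in> L2 M"
  shows "(\<lambda>x. f x - g x) \<in> L2 M"
  using L2_add[OF assms(1) L2_scale[OF assms(2), of "-1"]] by simp

lemma L2_sum [intro]:
  assumes "\<And>i. i \<in> I \<Longrightarrow> f i \<in> L2 M"
  shows "(\<lambda>x. \<Sum>i\<in>I. f i x) \<in> L2 M"
  using assms
proof (induction I rule: infinite_finite_induct)
  case (insert i I)
  then show ?case using L2_add[of "f i" M "\<lambda>x. \<Sum>i\<in>I. f i x"] by auto
qed (auto simp: L2_iff)

lemma L2_abs [intro]: "f \<in> L2 M \<Longrightarrow> (\<lambda>x. \<bar>f x\<bar>) \<in> L2 M"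
  by (auto simp: L2_iff)

lemma L2_inner_add_left:
  assumes "f \<in> L2 M" "g \<in> L2 M" "h \<in> L2 M"
  shows "L2_inner M (\<lambda>x. f x + g x) h = L2_inner M f h + L2_inner M g h"
  using assms by (simp add: L2_inner_def distrib_right L2_mult_integrable)

lemma L2_inner_diff_left:
  assumes "f \<in> L2 M" "g \<in> L2 M" "h \<in> L2 M"
  shows "L2_inner M (\<lambda>x. f x - g x) h = L2_inner M f h - L2_inner M g h"
  using assms by (simp add: L2_inner_def left_diff_distrib L2_mult_integrable)

lemma L2_inner_scale_left: "L2_inner M (\<lambda>x. c * f x) h = c * L2_inner M f h"
  by (simp add: L2_inner_def mult.assoc)

lemma L2_inner_add_right:
  assumes "f \<in> L2 M" "g \<in> L2 M" "h \<in> L2 M"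
  shows "L2_inner M h (\<lambda>x. f x + g x) = L2_inner M h f + L2_inner M h g"
  using L2_inner_add_left[OF assms] by (simp add: L2_inner_commute)

lemma L2_inner_diff_right:
  assumes "f \<in> L2 M" "g \<in> L2 M" "h \<in> L2 M"
  shows "L2_inner M h (\<lambda>x. f x - g x) = L2_inner M h f - L2_inner M h g"
  using L2_inner_diff_left[OF assms] by (simp add: L2_inner_commute)

lemma L2_inner_scale_right: "L2_inner M h (\<lambda>x. c * f x) = c * L2_inner M h f"
  using L2_inner_scale_left by (simp add: L2_inner_commute)

lemma L2_inner_sum_left:
  assumes "\<And>i. i \<in> I \<Longrightarrow> f i \<in> L2 M" "h \<in> L2 M"
  shows "L2_inner M (\<lambda>x. \<Sum>i\<in>I. f i x) h = (\<Sum>i\<in>I. L2_inner M (f i) h)"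
  using assms
  by (simp add: L2_inner_def sum_distrib_right L2_mult_integrable Bochner_Integration.integral_sum)

lemma L2_inner_sum_right:
  assumes "\<And>i. i \<in> I \<Longrightarrow> f i \<in> L2 M" "h \<in> L2 M"
  shows "L2_inner M h (\<lambda>x. \<Sum>i\<in>I. f i x) = (\<Sum>i\<in>I. L2_inner M h (f i))"
  using L2_inner_sum_left[OF assms] by (simp add: L2_inner_commute)

lemma L2_inner_cong_AE:
  assumes "AE x in M. f x = f' x" "AE x in M. g x = g' x"
    and "f \<in> L2 M" "f' \<in> L2 M" "g \<in> L2 M" "g' \<in> L2 M"
  shows "L2_inner M f g = L2_inner M f' g'"
  unfolding L2_inner_def
proof (rule integral_cong_AE)
  show "AE x in M. f x * g x = f' x * g' x"
    using assms(1,2) by eventually_elim simp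
qed (use assms in \<open>auto dest: L2_measurable\<close>)

lemma L2_inner_mono_AE:
  assumes "AE x in M. f x * g x \<le> f' x * g' x"
    and "f \<in> L2 M" "f' \<in> L2 M" "g \<in> L2 M" "g' \<in> L2 M"
  shows "L2_inner M f g \<le> L2_inner M f' g'"
  unfolding L2_inner_def using assms
  by (intro integral_mono_AE L2_mult_integrable)

lemma L2_inner_nonneg_AE:
  assumes "AE x in M. 0 \<le> f x * g x"
  shows "0 \<le> L2_inner M f g"
  unfolding L2_inner_def using assms by (rule integral_nonneg_AE)

lemma L2_Cauchy_Schwarz_sq:
  assumes "f \<in> L2 M" "g \<in> L2 M"
  shows "(L2_inner M f g)\<^sup>2 \<le> L2_inner M f f * L2_inner M g g"
proof (rule quadratic_nonneg_imp_discrim_le)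
  fix s :: real
  have "0 \<le> L2_inner M (\<lambda>x. f x - s * g x) (\<lambda>x. f x - s * g x)"
    by (rule L2_inner_self_nonneg)
  also have "\<dots> = L2_inner M f f - 2 * s * L2_inner M f g + s\<^sup>2 * L2_inner M g g"
    using assms
    by (simp add: L2_inner_diff_left L2_inner_diff_right L2_scale L2_diff L2_inner_scale_left
        L2_inner_scale_right L2_inner_commute[of M g f] power2_eq_square algebra_simps)
  finally show "0 \<le> L2_inner M f f - 2 * s * L2_inner M f g + s\<^sup>2 * L2_inner M g g" .
qed (rule L2_inner_self_nonneg)

lemma L2_Cauchy_Schwarz:
  assumes "f \<in> L2 M" "g \<in> L2 M"
  shows "\<bar>L2_inner M f g\<bar> \<le> Lp_norm M 2 f * Lp_norm M 2 g"
  using real_sqrt_le_mono[OF L2_Cauchy_Schwarz_sq[OF assms]]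
  by (simp add: Lp_norm_2 real_sqrt_mult)

text \<open>The filter is arbitrary because the limit is taken along sequences as well as for times
  decreasing to 0. In the latter case membership in \<open>L2 M\<close> holds only
  eventually.\<close>

lemma L2_inner_tendsto:
  assumes "\<forall>\<^sub>F n in F. u n \<in> L2 M" and f: "f \<in> L2 M" and g: "g \<in> L2 M"
    and lim: "((\<lambda>n. Lp_norm M 2 (\<lambda>x. u n x - f x)) \<longlongrightarrow> 0) F"
  shows "((\<lambda>n. L2_inner M (u n) g) \<longlongrightarrow> L2_inner M f g) F"
proof (rule LIM_zero_cancel, rule Lim_null_comparison)
  show "\<forall>\<^sub>F n in F. norm (L2_inner M (u n) g - L2_inner M f g)
      \<le> Lp_norm M 2 (\<lambda>x. u n x - f x) * Lp_norm M 2 g"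
    using assms(1)
  proof eventually_elim
    case (elim n)
    then show ?case
      using L2_Cauchy_Schwarz[OF L2_diff[OF elim f] g] f g by (simp add: L2_inner_diff_left)
  qed
  show "((\<lambda>n. Lp_norm M 2 (\<lambda>x. u n x - f x) * Lp_norm M 2 g) \<longlongrightarrow> 0) F"
    using tendsto_mult_right[OF lim] by simp
qed

section \<open>The L^2 seminorm and limits of functions\<close>

lemma Lp_norm_2_scale: "Lp_norm M 2 (\<lambda>x. c * f x) = \<bar>c\<bar> * Lp_norm M 2 f"
  by (simp add: Lp_norm_2 L2_inner_scale_left L2_inner_scale_right real_sqrt_mult
      flip: mult.assoc power2_eq_square)

lemma Lp_norm_2_triangle:
  assumes "f \<in> L2 M" "g \<in> L2 M"
  shows "Lp_norm M 2 (\<lambda>x. f x + g x) \<le> Lp_norm M 2 f + Lp_norm M 2 g"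
proof -
  have "L2_inner M (\<lambda>x. f x + g x) (\<lambda>x. f x + g x)
      = L2_inner M f f + 2 * L2_inner M f g + L2_inner M g g"
    using assms by (simp add: L2_inner_add_left L2_inner_add_right L2_add L2_inner_commute[of M g f])
  also have "\<dots> \<le> (Lp_norm M 2 f + Lp_norm M 2 g)\<^sup>2"
    using L2_Cauchy_Schwarz[OF assms]
    by (simp add: power2_sum Lp_norm_2 L2_inner_self_nonneg)
  finally show ?thesis
    by (simp add: Lp_norm_2 L2_inner_self_nonneg real_le_lsqrt)
qed

lemma Lp_norm_2_tendsto:
  assumes u: "\<And>n. u n \<in> L2 M" and f: "f \<in> L2 M"
    and lim: "(\<lambda>n. Lp_norm M 2 (\<lambda>x. u n x - f x)) \<longlonglongrightarrow> 0"
  shows "(\<lambda>n. Lp_norm M 2 (u n)) \<longlonglongrightarrow> Lp_norm M 2 f"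
proof (rule LIM_zero_cancel, rule Lim_null_comparison[OF _ lim])
  have "\<bar>Lp_norm M 2 (u n) - Lp_norm M 2 f\<bar> \<le> Lp_norm M 2 (\<lambda>x. u n x - f x)" for n
  proof -
    have "Lp_norm M 2 (\<lambda>x. f x - u n x) = Lp_norm M 2 (\<lambda>x. u n x - f x)"
      using Lp_norm_2_scale[of M "-1" "\<lambda>x. u n x - f x"] by simp
    then show ?thesis
      using Lp_norm_2_triangle[OF L2_diff[OF u[of n] f] f] Lp_norm_2_triangle[OF L2_diff[OF f u[of n]] u[of n]]
      by (simp add: abs_le_iff)
  qed
  then show "\<forall>\<^sub>F n in sequentially. norm (Lp_norm M 2 (u n) - Lp_norm M 2 f)
      \<le> Lp_norm M 2 (\<lambda>x. u n x - f x)"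
    by simp
qed

text \<open>Fatou's lemma. It is applied to \<open>ennreal\<close> integrals, whose finiteness
  yields integrability; a bound on the Bochner integral alone would not exclude its default value
  0.\<close>

lemma Lp_space_bound_liminf:
  fixes u :: "nat \<Rightarrow> 'a \<Rightarrow> real"
  assumes [measurable]: "f \<in> borel_measurable M" "\<And>n. u n \<in> borel_measurable M"
    and conv: "AE x in M. (\<lambda>n. u n x) \<longlonglongrightarrow> f x" and "0 < q" "0 \<le> B"
    and int: "\<And>n. integrable M (\<lambda>x. \<bar>u n x\<bar> powr q)" and bd: "\<And>n. (\<integral>x. \<bar>u n x\<bar> powr q \<partial>M) \<le> B"
  shows "f \<in> Lp_space M q" and "(\<integral>x. \<bar>f x\<bar> powr q \<partial>M) \<le> B"
proof -
  have "(\<integral>\<^sup>+x. ennreal (\<bar>f x\<bar> powr q) \<partial>M)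
      = (\<integral>\<^sup>+x. liminf (\<lambda>n. ennreal (\<bar>u n x\<bar> powr q)) \<partial>M)"
  proof (rule nn_integral_cong_AE)
    show "AE x in M. ennreal (\<bar>f x\<bar> powr q) = liminf (\<lambda>n. ennreal (\<bar>u n x\<bar> powr q))"
      using conv
    proof eventually_elim
      case (elim x)
      have "(\<lambda>n. ennreal (\<bar>u n x\<bar> powr q)) \<longlonglongrightarrow> ennreal (\<bar>f x\<bar> powr q)"
        using \<open>0 < q\<close> by (intro tendsto_ennrealI tendsto_powr2 tendsto_rabs elim) auto
      then show ?case
        by (intro lim_imp_Liminf[symmetric]) auto
    qed
  qed
  also have "\<dots> \<le> liminf (\<lambda>n. \<integral>\<^sup>+x. ennreal (\<bar>u n x\<bar> powr q) \<partial>M)"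
    by (rule nn_integral_liminf) measurable
  also have "\<dots> \<le> ennreal B"
  proof -
    have "(\<integral>\<^sup>+x. ennreal (\<bar>u n x\<bar> powr q) \<partial>M) \<le> ennreal B" for n
      using int[of n] bd[of n] by (simp add: nn_integral_eq_integral ennreal_leI)
    then have "liminf (\<lambda>n. \<integral>\<^sup>+x. ennreal (\<bar>u n x\<bar> powr q) \<partial>M) \<le> liminf (\<lambda>n. ennreal B)"
      by (intro Liminf_mono) auto
    then show ?thesis by (simp add: Liminf_const)
  qed
  finally have le: "(\<integral>\<^sup>+x. ennreal (\<bar>f x\<bar> powr q) \<partial>M) \<le> ennreal B" .
  have "integrable M (\<lambda>x. \<bar>f x\<bar> powr q)"
    using le by (intro integrableI_bounded) (auto simp: le_less_trans)
  then show "f \<in> Lp_space M q" "(\<integral>x. \<bar>f x\<bar> powr q \<partial>M) \<le> B"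
    using le \<open>0 \<le> B\<close> by (auto simp: Lp_space_def nn_integral_eq_integral)
qed

subsection \<open>The approximating forms\<close>

text \<open>By convexity the decrements \<open>a n - a (Suc n)\<close> do not increase with
  \<open>n\<close>, so the sum of the first \<open>n\<close> of them is at most \<open>n\<close>
  times the first.\<close>

lemma convex_sequence_le:
  fixes a :: "nat \<Rightarrow> real"
  assumes "\<And>n. 2 * a (Suc n) \<le> a n + a (Suc (Suc n))"
  shows "a 0 - a n \<le> real n * (a 0 - a 1)"
proof -
  have step: "a n - a (Suc n) \<le> a 0 - a 1" for n
  proof (induction n)
    case (Suc n)
    then show ?case using assms[of n] by simp
  qed simp
  show ?thesis
  proof (induction n)
    case (Suc n)
    then show ?case using step[of n] by (simp add: algebra_simps)
  qed simp
qed

context symmetric_Markov_semigroup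
begin

section \<open>Order properties and symmetry of the semigroup\<close>

lemma L2_const: "(\<lambda>_. c) \<in> L2 M"
  by (simp add: L2_iff)

lemma L2_min_const: "f \<in> L2 M \<Longrightarrow> (\<lambda>x. min (f x) c) \<in> L2 M"
  by (rule L2_AE_bound[OF L2_add[OF L2_abs[of f M] L2_const[of "\<bar>c\<bar>"]]]) auto

lemma L2_max_const: "f \<in> L2 M \<Longrightarrow> (\<lambda>x. max (f x) c) \<in> L2 M"
  by (rule L2_AE_bound[OF L2_add[OF L2_abs[of f M] L2_const[of "\<bar>c\<bar>"]]]) auto

lemma P_diff:
  assumes "0 \<le> t" "f \<in> L2 M" "g \<in> L2 M"
  shows "AE x in M. P t (\<lambda>y. f y - g y) x = P t f x - P t g x"
  using P_add[OF assms(1,2) L2_scale[OF assms(3), of "-1"]] P_scale[OF assms(1,3), of "-1"]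
  by eventually_elim simp

lemma P_mono:
  assumes "0 \<le> t" "f \<in> L2 M" "g \<in> L2 M" "AE x in M. f x \<le> g x"
  shows "AE x in M. P t f x \<le> P t g x"
proof -
  have "AE x in M. 0 \<le> P t (\<lambda>x. g x - f x) x"
    using assms by (intro P_nonneg L2_diff) auto
  then show ?thesis
    using P_diff[OF assms(1,3,2)] by eventually_elim simp
qed

lemma P_cong:
  assumes "0 \<le> t" "f \<in> L2 M" "g \<in> L2 M" "AE x in M. f x = g x"
  shows "AE x in M. P t f x = P t g x"
proof -
  have "AE x in M. f x \<le> g x" "AE x in M. g x \<le> f x"
    using assms(4) by (auto elim: eventually_mono)
  from P_mono[OF assms(1,2,3) this(1)] P_mono[OF assms(1,3,2) this(2)]
  show ?thesis by eventually_elim simp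
qed

lemma P_const:
  assumes "0 \<le> t"
  shows "AE x in M. P t (\<lambda>_. c) x = c"
  using P_scale[OF assms L2_const[of 1], of c] P_one[OF assms] by eventually_elim simp

lemma P_abs:
  assumes "0 \<le> t" "f \<in> L2 M"
  shows "AE x in M. \<bar>P t f x\<bar> \<le> P t (\<lambda>x. \<bar>f x\<bar>) x"
proof -
  have "AE x in M. P t f x \<le> P t (\<lambda>x. \<bar>f x\<bar>) x"
    using assms by (intro P_mono L2_abs) auto
  moreover have "AE x in M. P t (\<lambda>x. (-1) * f x) x \<le> P t (\<lambda>x. \<bar>f x\<bar>) x"
    using assms by (intro P_mono L2_abs L2_scale) auto
  ultimately show ?thesis
    using P_scale[OF assms, of "-1"] by eventually_elim simp
qed

lemma P_le_const:
  assumes "0 \<le> t" "f \<in> L2 M" "AE x in M. f x \<le> c"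
  shows "AE x in M. P t f x \<le> c"
  using P_mono[OF assms(1,2) L2_const assms(3)] P_const[OF assms(1), of c] by eventually_elim simp

lemma L2_inner_P:
  assumes "0 \<le> t" "f \<in> L2 M" "g \<in> L2 M"
  shows "L2_inner M f (P t g) = L2_inner M (P t f) g"
  using P_symmetric[OF assms] by (simp add: L2_inner_def)

lemma L2_inner_P_commute:
  assumes "0 \<le> t" "f \<in> L2 M" "g \<in> L2 M"
  shows "L2_inner M (P t f) g = L2_inner M (P t g) f"
  using L2_inner_P[OF assms] by (simp add: L2_inner_commute)

lemma L2_inner_P_semigroup:
  assumes "0 \<le> s" "0 \<le> t" "f \<in> L2 M" "g \<in> L2 M"
  shows "L2_inner M (P (s + t) f) g = L2_inner M (P t f) (P s g)"
proof -
  have "L2_inner M (P (s + t) f) g = L2_inner M (P s (P t f)) g"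
    using assms P_semigroup[OF assms(1,2,3)]
    by (intro L2_inner_cong_AE) (auto intro!: P_L2)
  then show ?thesis using assms by (simp add: L2_inner_P P_L2)
qed

text \<open>\<open>P t\<close> is the square of the self-adjoint operator \<open>P (t / 2)\<close>.
  This makes \<open>P t\<close> a positive operator and relates its quadratic form to L^2
  norms.\<close>

lemma L2_inner_P_self:
  assumes "0 \<le> t" "f \<in> L2 M"
  shows "L2_inner M (P t f) f = L2_inner M (P (t / 2) f) (P (t / 2) f)"
  using L2_inner_P_semigroup[of "t/2" "t/2" f f] assms by simp

lemma L2_inner_P_self_nonneg:
  assumes "0 \<le> t" "f \<in> L2 M"
  shows "0 \<le> L2_inner M (P t f) f"
  using L2_inner_P_self[OF assms] L2_inner_self_nonneg by simp

lemma L2_inner_P_diff_left: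
  assumes "0 \<le> t" "f \<in> L2 M" "g \<in> L2 M" "h \<in> L2 M"
  shows "L2_inner M (P t (\<lambda>x. f x - g x)) h = L2_inner M (P t f) h - L2_inner M (P t g) h"
proof -
  have "L2_inner M (P t (\<lambda>x. f x - g x)) h = L2_inner M (\<lambda>x. P t f x - P t g x) h"
    using assms by (intro L2_inner_cong_AE P_diff P_L2 L2_diff) auto
  then show ?thesis using assms by (simp add: L2_inner_diff_left P_L2)
qed

lemma L2_inner_P_add_left:
  assumes "0 \<le> t" "f \<in> L2 M" "g \<in> L2 M" "h \<in> L2 M"
  shows "L2_inner M (P t (\<lambda>x. f x + g x)) h = L2_inner M (P t f) h + L2_inner M (P t g) h"
proof -
  have "L2_inner M (P t (\<lambda>x. f x + g x)) h = L2_inner M (\<lambda>x. P t f x + P t g x) h"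
    using assms by (intro L2_inner_cong_AE P_add P_L2 L2_add) auto
  then show ?thesis using assms by (simp add: L2_inner_add_left P_L2)
qed

lemma L2_inner_P_scale_left:
  assumes "0 \<le> t" "f \<in> L2 M" "h \<in> L2 M"
  shows "L2_inner M (P t (\<lambda>x. c * f x)) h = c * L2_inner M (P t f) h"
proof -
  have "L2_inner M (P t (\<lambda>x. c * f x)) h = L2_inner M (\<lambda>x. c * P t f x) h"
    using assms by (intro L2_inner_cong_AE P_scale P_L2 L2_scale) auto
  then show ?thesis by (simp add: L2_inner_scale_left)
qed

text \<open>The bilinear form of the operator (I - \<open>P t\<close>) / \<open>t\<close>. It makes
  sense on all of \<open>L2 M\<close>, in particular for truncations, which may leave the domain of
  the generator.\<close>

definition approx_form :: "real \<Rightarrow> ('a \<Rightarrow> real) \<Rightarrow> ('a \<Rightarrow> real) \<Rightarrow> real" where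
  "approx_form t f g = (L2_inner M f g - L2_inner M (P t f) g) / t"

section \<open>Bilinearity and symmetry of the approximating forms\<close>

lemma approx_form_commute:
  assumes "0 \<le> t" "f \<in> L2 M" "g \<in> L2 M"
  shows "approx_form t f g = approx_form t g f"
  using L2_inner_P_commute[OF assms] by (simp add: approx_form_def L2_inner_commute)

lemma approx_form_add_left:
  assumes "0 \<le> t" "f \<in> L2 M" "g \<in> L2 M" "h \<in> L2 M"
  shows "approx_form t (\<lambda>x. f x + g x) h = approx_form t f h + approx_form t g h"
  using assms
  by (simp add: approx_form_def L2_inner_add_left L2_inner_P_add_left diff_divide_distrib add_divide_distrib)

lemma approx_form_diff_left:
  assumes "0 \<le> t" "f \<in> L2 M" "g \<in> L2 M" "h \<in> L2 M"
  shows "approx_form t (\<lambda>x. f x - g x) h = approx_form t f h - approx_form t g h"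
  using assms
  by (simp add: approx_form_def L2_inner_diff_left L2_inner_P_diff_left diff_divide_distrib)

lemma approx_form_scale_left:
  assumes "0 \<le> t" "f \<in> L2 M" "h \<in> L2 M"
  shows "approx_form t (\<lambda>x. c * f x) h = c * approx_form t f h"
  using assms
  by (simp add: approx_form_def L2_inner_scale_left L2_inner_P_scale_left right_diff_distrib diff_divide_distrib)

lemma approx_form_add_right:
  assumes "0 \<le> t" "f \<in> L2 M" "g \<in> L2 M" "h \<in> L2 M"
  shows "approx_form t h (\<lambda>x. f x + g x) = approx_form t h f + approx_form t h g"
  using assms
  by (simp add: approx_form_def L2_inner_add_right P_L2 diff_divide_distrib add_divide_distrib)

lemma approx_form_diff_right:
  assumes "0 \<le> t" "f \<in> L2 M" "g \<in> L2 M" "h \<in> L2 M"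
  shows "approx_form t h (\<lambda>x. f x - g x) = approx_form t h f - approx_form t h g"
  using assms
  by (simp add: approx_form_def L2_inner_diff_right P_L2 diff_divide_distrib)

lemma approx_form_scale_right: "approx_form t h (\<lambda>x. c * f x) = c * approx_form t h f"
  by (simp add: approx_form_def L2_inner_scale_right right_diff_distrib diff_divide_distrib)

lemma approx_form_diff_self:
  assumes "0 \<le> t" "f \<in> L2 M" "g \<in> L2 M"
  shows "approx_form t (\<lambda>x. f x - g x) (\<lambda>x. f x - g x)
    = approx_form t f f - 2 * approx_form t f g + approx_form t g g"
  using assms
  by (simp add: approx_form_diff_left approx_form_diff_right L2_diff approx_form_commute[of t g f])

lemma approx_form_add_self:
  assumes "0 \<le> t" "f \<in> L2 M" "g \<in> L2 M"
  shows "approx_form t (\<lambda>x. f x + g x) (\<lambda>x. f x + g x)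
    = approx_form t f f + 2 * approx_form t f g + approx_form t g g"
  using assms
  by (simp add: approx_form_add_left approx_form_add_right L2_add approx_form_commute[of t g f])

lemma approx_form_scale_self:
  assumes "0 \<le> t" "f \<in> L2 M"
  shows "approx_form t (\<lambda>x. c * f x) (\<lambda>x. c * f x) = c\<^sup>2 * approx_form t f f"
  using assms
  by (simp add: approx_form_scale_left approx_form_scale_right L2_scale power2_eq_square)

text \<open>The second difference of the sequence is the quadratic form of
  \<open>P (real n * t)\<close> at \<open>f - P t f\<close>, which is nonnegative because that
  operator is a square.\<close>

lemma P_multiples_convex:
  assumes "0 \<le> t" "f \<in> L2 M"
  shows "2 * L2_inner M (P (real (Suc n) * t) f) f
    \<le> L2_inner M (P (real n * t) f) f + L2_inner M (P (real (Suc (Suc n)) * t) f) f"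
proof -
  define s where "s = real n * t"
  have s: "0 \<le> s" using assms by (simp add: s_def)
  let ?g = "\<lambda>x. f x - P t f x"
  have g: "?g \<in> L2 M" "P t f \<in> L2 M" "P s f \<in> L2 M" using assms s by (auto intro: P_L2)
  have 1: "L2_inner M (P s (P t f)) f = L2_inner M (P (s + t) f) f"
    using assms s P_semigroup[OF s assms]
    by (intro L2_inner_cong_AE) (auto intro!: P_L2)
  have 2: "L2_inner M (P s f) (P t f) = L2_inner M (P (t + s) f) f"
    using L2_inner_P_semigroup[of t s f f] assms s by simp
  have "L2_inner M (P s (P t f)) (P t f) = L2_inner M (P (s + t) f) (P t f)"
    using assms s P_semigroup[OF s assms]
    by (intro L2_inner_cong_AE) (auto intro!: P_L2)
  also have "\<dots> = L2_inner M (P (t + (s + t)) f) f"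
    using L2_inner_P_semigroup[of t "s + t" f f] assms s by simp
  finally have 3: "L2_inner M (P s (P t f)) (P t f) = L2_inner M (P (s + 2 * t) f) f"
    by (simp add: algebra_simps)
  have "0 \<le> L2_inner M (P s ?g) ?g"
    by (rule L2_inner_P_self_nonneg[OF s g(1)])
  also have "\<dots> = L2_inner M (P s f) f - 2 * L2_inner M (P (s + t) f) f + L2_inner M (P (s + 2 * t) f) f"
    using assms s g 1 2 3
    by (simp add: L2_inner_P_diff_left L2_inner_diff_right P_L2 add.commute)
  finally show ?thesis by (simp add: s_def algebra_simps)
qed

lemma P_multiples_le:
  assumes "0 \<le> t" "f \<in> L2 M"
  shows "L2_inner M f f - L2_inner M (P (real n * t) f) f
    \<le> real n * (L2_inner M f f - L2_inner M (P t f) f)"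
proof -
  have "L2_inner M (P 0 f) f = L2_inner M f f"
    using assms P_zero[OF assms(2)] by (intro L2_inner_cong_AE) (auto intro: P_L2)
  then show ?thesis
    using convex_sequence_le[of "\<lambda>n. L2_inner M (P (real n * t) f) f", OF P_multiples_convex[OF assms], of n]
    by simp
qed

text \<open>Spectrally, (1 - exp (-t x)) / t decreases in t. Convexity of the sequence above gives
  this along integer multiples of \<open>t\<close> without a spectral representation.\<close>

lemma approx_form_multiple_le:
  assumes "0 < t" "f \<in> L2 M" "0 < n"
  shows "approx_form (real n * t) f f \<le> approx_form t f f"
  using divide_right_mono[OF P_multiples_le[of t f n], of "real n * t"] assms
  by (simp add: approx_form_def)

text \<open>A convex sequence that is bounded above cannot increase.\<close>

lemma P_bounded_contraction:
  assumes "0 \<le> t" "f \<in> L2 M" "AE x in M. \<bar>f x\<bar> \<le> B"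
  shows "L2_inner M (P t f) f \<le> L2_inner M f f"
proof (rule ccontr)
  let ?d = "L2_inner M (P t f) f - L2_inner M f f"
  assume "\<not> ?thesis"
  then have d: "?d > 0" by simp
  have bd: "L2_inner M (P s f) f \<le> B\<^sup>2" if s: "0 \<le> s" for s
  proof -
    have "AE x in M. P s (\<lambda>x. \<bar>f x\<bar>) x \<le> B"
      using assms s by (intro P_le_const) auto
    then have "AE x in M. P s f x * f x \<le> B * B"
      using P_abs[OF s assms(2)] assms(3)
    proof eventually_elim
      case (elim x)
      have "P s f x * f x \<le> \<bar>P s f x\<bar> * \<bar>f x\<bar>" by (simp flip: abs_mult)
      also have "\<dots> \<le> B * B" using elim by (intro mult_mono) auto
      finally show ?case .
    qed
    then have "L2_inner M (P s f) f \<le> L2_inner M (\<lambda>_. B) (\<lambda>_. B)"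
      using assms s by (intro L2_inner_mono_AE L2_const P_L2)
    then show ?thesis by (simp add: L2_inner_def power2_eq_square prob_space)
  qed
  \<comment> \<open>An increase by \<open>?d\<close> over one step of length \<open>t\<close> forces
    growth by at least \<open>n\<close> times \<open>?d\<close> over \<open>n\<close> steps, which
    eventually passes the uniform bound \<open>B\<^sup>2\<close>.\<close>
  obtain n where n: "(B\<^sup>2 - L2_inner M f f) < real n * ?d"
    using reals_Archimedean3[OF d] by blast
  show False
    using P_multiples_le[OF assms(1,2), of n] bd[of "real n * t"] n assms(1)
    by (simp add: algebra_simps)
qed

text \<open>Truncate at height \<open>n\<close>. Pairing \<open>f - g n \<ge> 0\<close> with
  \<open>P t (g n) \<le> P t f\<close> and using symmetry gives 2<g, Pf> - <f, Pf> \<le> <g, Pg>,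
  where the bounded case applies on the right. Only pairings with the fixed function
  \<open>P t f\<close> then remain for the limit, so dominated convergence suffices.\<close>

lemma P_nonneg_contraction:
  assumes t: "0 \<le> t" and f: "f \<in> L2 M" and nn: "\<And>x. 0 \<le> f x"
  shows "L2_inner M (P t f) f \<le> L2_inner M f f"
proof -
  define g where "g n = (\<lambda>x. min (f x) (real n))" for n :: nat
  have g: "g n \<in> L2 M" for n using f by (simp add: g_def L2_min_const)
  have gn: "0 \<le> g n x" "g n x \<le> f x" "g n x \<le> real n" for n x
    using nn by (auto simp: g_def)
  have Pf: "P t f \<in> L2 M" "P t (g n) \<in> L2 M" for n using t f g by (auto intro: P_L2)
  have Pfnn: "AE x in M. 0 \<le> P t f x" using t f nn by (intro P_nonneg) auto
  have lim: "(\<lambda>n. L2_inner M (g n) (P t f)) \<longlonglongrightarrow> L2_inner M f (P t f)"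
    unfolding L2_inner_def
  proof (rule integral_dominated_convergence)
    show "integrable M (\<lambda>x. f x * P t f x)" using f Pf by (intro L2_mult_integrable)
    show "(\<lambda>x. f x * P t f x) \<in> borel_measurable M"
      "\<And>n. (\<lambda>x. g n x * P t f x) \<in> borel_measurable M"
      using f Pf g by (auto dest!: L2_measurable)
    show "AE x in M. (\<lambda>n. g n x * P t f x) \<longlonglongrightarrow> f x * P t f x"
    proof (rule AE_I2)
      fix x
      obtain N where "f x \<le> real N" using real_arch_simple by blast
      then have "\<forall>\<^sub>F n in sequentially. g n x = f x"
        by (intro eventually_sequentiallyI[of N]) (auto simp: g_def)
      then have "\<forall>\<^sub>F n in sequentially. g n x * P t f x = f x * P t f x"
        by eventually_elim simp
      then show "(\<lambda>n. g n x * P t f x) \<longlonglongrightarrow> f x * P t f x"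
        by (rule tendsto_eventually)
    qed
    show "AE x in M. norm (g n x * P t f x) \<le> f x * P t f x" for n
      using Pfnn by eventually_elim (use gn nn in \<open>auto simp: abs_mult intro!: mult_mono\<close>)
  qed
  have ineq: "2 * L2_inner M (g n) (P t f) - L2_inner M f (P t f) \<le> L2_inner M f f" for n
  proof -
    have "L2_inner M (\<lambda>x. f x - g n x) (P t (g n)) \<le> L2_inner M (\<lambda>x. f x - g n x) (P t f)"
    proof (rule L2_inner_mono_AE)
      have "AE x in M. P t (g n) x \<le> P t f x"
        using t f g gn by (intro P_mono) auto
      then show "AE x in M. (f x - g n x) * P t (g n) x \<le> (f x - g n x) * P t f x"
        by eventually_elim (use gn in \<open>auto intro: mult_left_mono\<close>)
    qed (use f g Pf in auto)
    then have "2 * L2_inner M (g n) (P t f) - L2_inner M f (P t f) \<le> L2_inner M (P t (g n)) (g n)"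
      using f g Pf t
      by (simp add: L2_inner_diff_left L2_inner_P L2_inner_P_commute[of t f "g n"])
    also have "\<dots> \<le> L2_inner M (g n) (g n)"
      using t g gn by (intro P_bounded_contraction[of _ _ "real n"]) auto
    also have "\<dots> \<le> L2_inner M f f"
      using f g gn nn by (intro L2_inner_mono_AE) (auto intro!: AE_I2 mult_mono)
    finally show ?thesis .
  qed
  have "(\<lambda>n. 2 * L2_inner M (g n) (P t f) - L2_inner M f (P t f))
      \<longlonglongrightarrow> 2 * L2_inner M f (P t f) - L2_inner M f (P t f)"
    by (intro tendsto_intros lim)
  then have "2 * L2_inner M f (P t f) - L2_inner M f (P t f) \<le> L2_inner M f f"
    using ineq by (intro LIMSEQ_le_const2) auto
  then show ?thesis by (simp add: L2_inner_commute)
qed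

section \<open>Nonnegativity of the approximating forms and their behaviour under truncation\<close>

lemma L2_inner_P_abs:
  assumes t: "0 \<le> t" and f: "f \<in> L2 M"
  shows "L2_inner M (P t f) f \<le> L2_inner M (P t (\<lambda>x. \<bar>f x\<bar>)) (\<lambda>x. \<bar>f x\<bar>)"
proof (rule L2_inner_mono_AE)
  show "AE x in M. P t f x * f x \<le> P t (\<lambda>x. \<bar>f x\<bar>) x * \<bar>f x\<bar>"
    using P_abs[OF t f]
  proof eventually_elim
    case (elim x)
    have "P t f x * f x \<le> \<bar>P t f x\<bar> * \<bar>f x\<bar>" by (simp flip: abs_mult)
    also have "\<dots> \<le> P t (\<lambda>x. \<bar>f x\<bar>) x * \<bar>f x\<bar>" using elim by (intro mult_right_mono) auto
    finally show ?case .
  qed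
qed (use assms in \<open>auto intro: P_L2\<close>)

lemma L2_inner_abs_self: "L2_inner M (\<lambda>x. \<bar>f x\<bar>) (\<lambda>x. \<bar>f x\<bar>) = L2_inner M f f"
  by (simp add: L2_inner_def)

lemma approx_form_abs_le:
  assumes "0 < t" "f \<in> L2 M"
  shows "approx_form t (\<lambda>x. \<bar>f x\<bar>) (\<lambda>x. \<bar>f x\<bar>) \<le> approx_form t f f"
  using L2_inner_P_abs[of t f] assms
  by (simp add: approx_form_def L2_inner_abs_self divide_right_mono)

text \<open>Passing to the absolute value keeps the norm and can only increase the term with
  \<open>P t\<close>, which reduces the claim to nonnegative functions.\<close>

lemma approx_form_nonneg:
  assumes t: "0 < t" and f: "f \<in> L2 M"
  shows "0 \<le> approx_form t f f"
proof -
  have "L2_inner M (P t f) f \<le> L2_inner M f f"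
    using L2_inner_P_abs[of t f] P_nonneg_contraction[of t "\<lambda>x. \<bar>f x\<bar>"] assms L2_abs[OF f]
    by (auto simp: L2_inner_abs_self)
  then show ?thesis using t by (simp add: approx_form_def)
qed

text \<open>Where \<open>max (h x - c) 0\<close> is nonzero, \<open>min h c\<close> attains its maximum \<open>c\<close>, hence there it
  dominates its image under the semigroup.\<close>

lemma approx_form_layers:
  assumes t: "0 < t" and h: "h \<in> L2 M" and nn: "\<And>x. 0 \<le> h x" and c: "0 \<le> c"
  defines "u \<equiv> \<lambda>x. min (h x) c" and "v \<equiv> \<lambda>x. max (h x - c) 0"
  shows "approx_form t u u + approx_form t v v \<le> approx_form t h h"
    and "L2_inner M u u + L2_inner M v v \<le> L2_inner M h h"
proof -
  have u: "u \<in> L2 M" using h by (simp add: u_def L2_min_const)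
  have v: "v \<in> L2 M"
    using L2_max_const[OF L2_diff[OF h L2_const[of c]]] by (simp add: v_def)
  have Pu: "P t u \<in> L2 M" using u t by (auto intro: P_L2)
  have huv: "h = (\<lambda>x. u x + v x)" by (auto simp: u_def v_def min_def max_def)
  have "AE x in M. P t u x \<le> c"
    using t u by (intro P_le_const) (auto simp: u_def)
  then have "AE x in M. 0 \<le> (u x - P t u x) * v x"
    by eventually_elim (auto simp: u_def v_def max_def min_def)
  then have "0 \<le> L2_inner M (\<lambda>x. u x - P t u x) v" by (rule L2_inner_nonneg_AE)
  then have "0 \<le> approx_form t u v"
    using t u v Pu by (simp add: approx_form_def L2_inner_diff_left)
  then show "approx_form t u u + approx_form t v v \<le> approx_form t h h"
    using approx_form_add_self[of t u v] t u v unfolding huv by simp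
  have "0 \<le> L2_inner M u v"
    using nn c by (intro L2_inner_nonneg_AE AE_I2) (simp add: u_def v_def)
  then show "L2_inner M u u + L2_inner M v v \<le> L2_inner M h h"
    using u v unfolding huv
    by (simp add: L2_inner_add_left L2_inner_add_right L2_add L2_inner_commute[of M v u])
qed

end

subsection \<open>Ultracontractivity\<close>

text \<open>Beyond some \<open>X\<close> the Gaussian absorbs the power and the factor (1 + x)^2; a
  crude bound on the remaining range enters \<open>c\<close>. The quadratic denominator is the one
  that is summed by telescoping below.\<close>

lemma powr_mult_exp_neg_square_bounded:
  fixes a r :: real
  assumes "0 < a" "0 < r"
  obtains c where "0 < c" "\<And>x. 0 \<le> x \<Longrightarrow> x powr r * exp (- a * x\<^sup>2) \<le> c / (1 + x)\<^sup>2"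
proof -
  have "((\<lambda>x::real. x powr r * exp (- a * x\<^sup>2) * (1 + x)\<^sup>2) \<longlongrightarrow> 0) at_top"
    using assms by real_asymp
  then have "\<forall>\<^sub>F x in at_top. x powr r * exp (- a * x\<^sup>2) * (1 + x)\<^sup>2 < 1"
    by (rule order_tendstoD) simp
  then obtain X where X: "\<And>x. X \<le> x \<Longrightarrow> x powr r * exp (- a * x\<^sup>2) * (1 + x)\<^sup>2 < 1"
    by (auto simp: eventually_at_top_linorder)
  define c where "c = 1 + \<bar>X\<bar> powr r * (1 + \<bar>X\<bar>)\<^sup>2"
  have "0 < c" by (simp add: c_def add_pos_nonneg)
  moreover have "x powr r * exp (- a * x\<^sup>2) \<le> c / (1 + x)\<^sup>2" if x: "0 \<le> x" for x
  proof -
    have "x powr r * exp (- a * x\<^sup>2) * (1 + x)\<^sup>2 \<le> c"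
    proof (cases "X \<le> x")
      case True
      have "x powr r * exp (- a * x\<^sup>2) * (1 + x)\<^sup>2 \<le> 1" using X[OF True] by simp
      also have "1 \<le> c" by (simp add: c_def)
      finally show ?thesis .
    next
      case False
      have "x powr r * exp (- a * x\<^sup>2) * (1 + x)\<^sup>2 \<le> \<bar>X\<bar> powr r * 1 * (1 + \<bar>X\<bar>)\<^sup>2"
        using False x assms by (intro mult_mono powr_mono2 power_mono) auto
      then show ?thesis by (simp add: c_def)
    qed
    then show ?thesis using x by (simp add: pos_le_divide_eq)
  qed
  ultimately show thesis by (rule that)
qed

text \<open>Telescoping: \<open>s / (1 + s k)\<^sup>2 \<le> 1 / (1 + s (k - 1)) - 1 / (1 + s k)\<close>.\<close>

lemma sum_inverse_square_le:
  fixes s :: real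
  assumes "0 < s"
  shows "(\<Sum>k=1..<n. 1 / (1 + s * real k)\<^sup>2) \<le> 1 / s"
proof -
  have tele: "s * (\<Sum>k=1..<Suc n. 1 / (1 + s * real k)\<^sup>2) \<le> 1 - 1 / (1 + s * real n)" for n
  proof (induction n)
    case (Suc n)
    define b where "b = 1 + s * real n"
    have b: "0 < b" using assms by (simp add: b_def add_pos_nonneg)
    have e: "1 + s * real (Suc n) = b + s" by (simp add: b_def algebra_simps)
    have "s / (b + s)\<^sup>2 \<le> s / (b * (b + s))"
      using assms b by (intro divide_left_mono) (auto simp: power2_eq_square)
    also have "\<dots> = 1 / b - 1 / (b + s)" using assms b by (simp add: field_simps)
    finally have "s / (b + s)\<^sup>2 \<le> 1 / b - 1 / (b + s)" .
    moreover have "(\<Sum>k=1..<Suc (Suc n). 1 / (1 + s * real k)\<^sup>2)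
        = (\<Sum>k=1..<Suc n. 1 / (1 + s * real k)\<^sup>2) + 1 / (b + s)\<^sup>2"
      using e by (subst sum.atLeastLessThan_Suc) simp_all
    ultimately show ?case
      using Suc unfolding e by (simp only: distrib_left b_def[symmetric] times_divide_eq_right mult_1_right)
  qed simp
  have "s * (\<Sum>k=1..<n. 1 / (1 + s * real k)\<^sup>2) \<le> 1"
  proof (cases n)
    case (Suc m)
    have "0 \<le> 1 / (1 + s * real m)" using assms by simp
    then show ?thesis unfolding Suc using tele[of m] by linarith
  qed simp
  then show ?thesis using assms by (simp add: field_simps)
qed

text \<open>In the variable x = sqrt t * k the summand is t^(-p) x^(2p) exp(-2a x^2). Summing its
  bound over points at distance sqrt t costs the further factor t^(-1/2).\<close>

lemma sum_powr_exp_neg_square_le: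
  fixes a p :: real
  assumes "0 < a" "0 < p"
  obtains c where "0 < c"
    "\<And>t n. 0 < t \<Longrightarrow> (\<Sum>k=1..<n. (real k powr p * exp (- a * t * (real k)\<^sup>2))\<^sup>2) \<le> c * t powr (- (p + 1/2))"
proof -
  obtain c where c: "0 < c" "\<And>x. 0 \<le> x \<Longrightarrow> x powr (2 * p) * exp (- (2 * a) * x\<^sup>2) \<le> c / (1 + x)\<^sup>2"
    using powr_mult_exp_neg_square_bounded[of "2 * a" "2 * p"] assms by auto
  have "(\<Sum>k=1..<n. (real k powr p * exp (- a * t * (real k)\<^sup>2))\<^sup>2) \<le> c * t powr (- (p + 1/2))"
    if t: "0 < t" for t n
  proof -
    define s where "s = sqrt t"
    have s: "0 < s" "s\<^sup>2 = t" using t by (auto simp: s_def)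
    have "(real k powr p * exp (- a * t * (real k)\<^sup>2))\<^sup>2 \<le> t powr (-p) * c * (1 / (1 + s * real k)\<^sup>2)"
      for k
    proof -
      have "(real k powr p * exp (- a * t * (real k)\<^sup>2))\<^sup>2
          = real k powr (2 * p) * exp (- (2 * a) * (s * real k)\<^sup>2)"
        by (simp add: power_mult_distrib power2_eq_square[of "_ powr _"] s(2) algebra_simps
            flip: exp_double powr_add)
      also have "real k powr (2 * p) = t powr (-p) * (s * real k) powr (2 * p)"
        using s t by (simp add: powr_mult powr_powr s_def powr_half_sqrt[symmetric] powr_minus field_simps)
      finally show ?thesis
        using mult_left_mono[OF c(2)[of "s * real k"], of "t powr (-p)"] s by (simp add: mult.assoc)
    qed
    then have "(\<Sum>k=1..<n. (real k powr p * exp (- a * t * (real k)\<^sup>2))\<^sup>2)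
        \<le> (\<Sum>k=1..<n. t powr (-p) * c * (1 / (1 + s * real k)\<^sup>2))"
      by (rule sum_mono)
    also have "\<dots> = t powr (-p) * c * (\<Sum>k=1..<n. 1 / (1 + s * real k)\<^sup>2)"
      by (simp add: sum_distrib_left)
    also have "\<dots> \<le> t powr (-p) * c * (1 / s)"
      using c(1) by (intro mult_left_mono sum_inverse_square_le s) auto
    also have "1 / s = t powr (- (1/2))"
      using t by (simp add: s_def powr_half_sqrt powr_minus_divide)
    also have "t powr (-p) * c * t powr (- (1/2)) = c * t powr (- (p + 1/2))"
      by (simp add: powr_add[symmetric] algebra_simps)
    finally show ?thesis .
  qed
  with c(1) show thesis by (rule that)
qed

section \<open>Expansions along the orthogonal decomposition\<close>

lemma Linf_norm_AE_le:
  assumes "Linf_norm M f \<le> ereal b"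
  shows "AE x in M. \<bar>f x\<bar> \<le> b"
  using esssup_AE[of "\<lambda>x. ereal \<bar>f x\<bar>" M] assms
  by (auto simp: Linf_norm_def elim!: eventually_mono dest: order_trans)

lemma L2_inner_orthogonal_sum:
  fixes h :: "nat \<Rightarrow> 'a \<Rightarrow> real"
  assumes "\<And>k. h k \<in> L2 M" "\<And>j k. j \<noteq> k \<Longrightarrow> L2_inner M (h j) (h k) = 0"
  shows "L2_inner M (\<lambda>x. \<Sum>k<n. h k x) (\<lambda>x. \<Sum>k<n. h k x) = (\<Sum>k<n. L2_inner M (h k) (h k))"
proof -
  have "L2_inner M (\<lambda>x. \<Sum>k<n. h k x) (\<lambda>x. \<Sum>k<n. h k x) = (\<Sum>j<n. \<Sum>k<n. L2_inner M (h j) (h k))"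
    using assms(1) by (simp add: L2_inner_sum_left L2_inner_sum_right L2_sum)
  also have "\<dots> = (\<Sum>j<n. \<Sum>k<n. if j = k then L2_inner M (h j) (h j) else 0)"
    using assms(2) by (intro sum.cong refl) auto
  also have "\<dots> = (\<Sum>k<n. L2_inner M (h k) (h k))"
    by (intro sum.cong refl) simp
  finally show ?thesis .
qed

text \<open>The last property is Bessel's inequality: by orthogonality the sums of squares are the
  squared norms of the partial sums, and they increase to the squared norm of
  \<open>f\<close>.\<close>

lemma orthogonal_decompositionE:
  assumes dec: "orthogonal_decomposition M H" and f: "f \<in> L2 M"
  obtains h where "\<And>k. h k \<in> H k" "\<And>k. h k \<in> L2 M"
    "(\<lambda>n. Lp_norm M 2 (\<lambda>x. (\<Sum>k<n. h k x) - f x)) \<longlonglongrightarrow> 0"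
    "\<And>n. (\<Sum>k<n. (Lp_norm M 2 (h k))\<^sup>2) \<le> (Lp_norm M 2 f)\<^sup>2"
proof -
  obtain h where h: "\<And>k. h k \<in> H k"
    and lim: "(\<lambda>n. Lp_norm M 2 (\<lambda>x. f x - (\<Sum>k<n. h k x))) \<longlonglongrightarrow> 0"
    using dec f unfolding orthogonal_decomposition_def by blast
  have hL2: "h k \<in> L2 M" for k
    using dec h[of k] unfolding orthogonal_decomposition_def L2_subspace_def by blast
  have orth: "L2_inner M (h j) (h k) = 0" if "j \<noteq> k" for j k
    using dec h[of j] h[of k] that unfolding orthogonal_decomposition_def L2_inner_def by blast
  have lim': "(\<lambda>n. Lp_norm M 2 (\<lambda>x. (\<Sum>k<n. h k x) - f x)) \<longlonglongrightarrow> 0"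
  proof -
    have "Lp_norm M 2 (\<lambda>x. (\<Sum>k<n. h k x) - f x) = Lp_norm M 2 (\<lambda>x. f x - (\<Sum>k<n. h k x))" for n
      using Lp_norm_2_scale[of M "-1" "\<lambda>x. f x - (\<Sum>k<n. h k x)"] by simp
    then show ?thesis using lim by simp
  qed
  let ?S = "\<lambda>n. \<Sum>k<n. (Lp_norm M 2 (h k))\<^sup>2"
  have "(Lp_norm M 2 (\<lambda>x. \<Sum>k<n. h k x))\<^sup>2 = ?S n" for n
    using L2_inner_orthogonal_sum[of h M n] hL2 orth
    by (simp add: Lp_norm_2 L2_inner_self_nonneg sum_nonneg)
  then have "?S \<longlonglongrightarrow> (Lp_norm M 2 f)\<^sup>2"
    using tendsto_power[OF Lp_norm_2_tendsto[OF L2_sum[OF hL2] f lim'], of 2] by simp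
  then have "?S n \<le> (Lp_norm M 2 f)\<^sup>2" for n
    by (intro incseq_le) (auto simp: incseq_Suc_iff)
  with h hL2 lim' show thesis by (rule that)
qed

context symmetric_Markov_semigroup
begin

lemma P_sum:
  assumes t: "0 \<le> t" and "finite I" and h: "\<And>k. k \<in> I \<Longrightarrow> h k \<in> L2 M"
  shows "AE x in M. P t (\<lambda>x. \<Sum>k\<in>I. h k x) x = (\<Sum>k\<in>I. P t (h k) x)"
  using assms(2) h
proof (induction I rule: finite_induct)
  case empty
  then show ?case using P_const[OF t, of 0] by simp
next
  case (insert i I)
  have "AE x in M. P t (\<lambda>x. h i x + (\<Sum>k\<in>I. h k x)) x = P t (h i) x + P t (\<lambda>x. \<Sum>k\<in>I. h k x) x"
    using insert.prems by (intro P_add t L2_sum) auto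
  moreover have "AE x in M. P t (\<lambda>x. \<Sum>k\<in>I. h k x) x = (\<Sum>k\<in>I. P t (h k) x)"
    using insert by auto
  ultimately show ?case
    by eventually_elim (use insert.hyps in simp)
qed

text \<open>Supplies the component of index 0, which the assumed decay estimate for
  \<open>k \<ge> 1\<close> does not cover.\<close>

lemma P_constant_function_bound:
  assumes t: "0 \<le> t" and f: "f \<in> constant_functions M"
  shows "AE x in M. \<bar>P t f x\<bar> \<le> Lp_norm M 2 f"
proof -
  obtain c where c: "AE x in M. f x = c" and fL: "f \<in> L2 M"
    using f by (auto simp: constant_functions_def)
  have "L2_inner M f f = L2_inner M (\<lambda>_. c) (\<lambda>_. c)"
    using c fL by (intro L2_inner_cong_AE L2_const) auto
  then have "Lp_norm M 2 f = \<bar>c\<bar>" by (simp add: Lp_norm_2 L2_inner_def prob_space)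
  then show ?thesis
    using P_cong[OF t fL L2_const c] P_const[OF t, of c] by (auto elim!: eventually_elim2)
qed

text \<open>A duality argument. Expand \<open>u = P t g\<close> itself into partial sums
  \<open>S n\<close>. Symmetry moves \<open>P t\<close> onto \<open>S n\<close>, where the decay
  estimate gives a sup bound proportional to the norm of \<open>u\<close>; pairing with
  \<open>g\<close> then leaves its L^1 norm, and one factor of the norm of \<open>u\<close>
  cancels.\<close>

proposition ultracontractive:
  fixes H :: "nat \<Rightarrow> ('a \<Rightarrow> real) set" and a C p :: real
  assumes dec: "orthogonal_decomposition M H" and H0: "H 0 = constant_functions M"
    and a: "0 < a" and C: "0 < C" and p: "0 < p"
    and bd: "\<And>k f t. 1 \<le> k \<Longrightarrow> f \<in> H k \<Longrightarrow> 0 < t \<Longrightarrow>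
      Linf_norm M (P t f) \<le> ereal (C * real k powr p * exp (- a * t * (real k)\<^sup>2) * Lp_norm M 2 f)"
  obtains K where "0 < K"
    "\<And>t g. 0 < t \<Longrightarrow> t \<le> 1 \<Longrightarrow> g \<in> L2 M \<Longrightarrow>
      L2_inner M (P t g) (P t g) \<le> K * t powr (- (p + 1/2)) * (\<integral>x. \<bar>g x\<bar> \<partial>M)\<^sup>2"
proof -
  obtain c where c: "0 < c" and sumc: "\<And>t n. 0 < t \<Longrightarrow>
      (\<Sum>k=1..<n. (real k powr p * exp (- a * t * (real k)\<^sup>2))\<^sup>2) \<le> c * t powr (- (p + 1/2))"
    using sum_powr_exp_neg_square_le[OF a p] by blast
  \<comment> \<open>The summand 1 accounts for the constant component, \<open>C * sqrt c\<close> for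
    all the others.\<close>
  define K where "K = (1 + C * sqrt c)\<^sup>2"
  have "0 < 1 + C * sqrt c" using C c by (simp add: add_pos_nonneg)
  then have "0 < K" by (simp add: K_def)
  moreover have "L2_inner M (P t g) (P t g) \<le> K * t powr (- (p + 1/2)) * (\<integral>x. \<bar>g x\<bar> \<partial>M)\<^sup>2"
    if t: "0 < t" "t \<le> 1" and g: "g \<in> L2 M" for t g
  proof -
    define u where "u = P t g"
    define T where "T = sqrt (t powr (- (p + 1/2)))"
    \<comment> \<open>The restriction to \<open>t \<le> 1\<close> enters here: the constant
      component does not decay, and it is absorbed since \<open>T \<ge> 1\<close>.\<close>
    have "1 \<le> t powr (- (p + 1/2))"
      using powr_mono2'[of "-(p + 1/2)" t 1] t p by simp
    then have T: "1 \<le> T" by (simp add: T_def)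
    have u: "u \<in> L2 M" using g t by (auto simp: u_def intro: P_L2)
    obtain h where h: "\<And>k. h k \<in> H k" "\<And>k. h k \<in> L2 M"
      and lim: "(\<lambda>n. Lp_norm M 2 (\<lambda>x. (\<Sum>k<n. h k x) - u x)) \<longlonglongrightarrow> 0"
      and hn: "\<And>n. (\<Sum>k<n. (Lp_norm M 2 (h k))\<^sup>2) \<le> (Lp_norm M 2 u)\<^sup>2"
      using orthogonal_decompositionE[OF dec u] by blast
    have norm_nn: "0 \<le> Lp_norm M 2 f" for f by (simp add: Lp_norm_2 L2_inner_self_nonneg)
    define B where "B = (1 + C * sqrt c) * T * Lp_norm M 2 u"
    define S where "S n = (\<lambda>x. \<Sum>k<n. h k x)" for n
    have S: "S n \<in> L2 M" for n using h by (auto simp: S_def)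
    have PS: "AE x in M. \<bar>P t (S n) x\<bar> \<le> B" if "1 \<le> n" for n
    proof -
      define b where "b k = real k powr p * exp (- a * t * (real k)\<^sup>2)" for k
      have "AE x in M. \<bar>P t (h k) x\<bar> \<le> C * b k * Lp_norm M 2 (h k)" if "1 \<le> k" for k
        using Linf_norm_AE_le[OF bd[OF that h(1) t(1)]] by (simp add: b_def mult.assoc)
      then have "AE x in M. \<forall>k\<in>{1..<n}. \<bar>P t (h k) x\<bar> \<le> C * b k * Lp_norm M 2 (h k)"
        by (simp add: AE_finite_all)
      moreover have "AE x in M. \<bar>P t (h 0) x\<bar> \<le> Lp_norm M 2 (h 0)"
        using h(1)[of 0] t unfolding H0 by (intro P_constant_function_bound) auto
      moreover have "AE x in M. P t (S n) x = (\<Sum>k<n. P t (h k) x)"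
        unfolding S_def using t h by (intro P_sum) auto
      ultimately show ?thesis
      proof eventually_elim
        case (elim x)
        have split: "(\<Sum>k<n. f k) = f 0 + (\<Sum>k=1..<n. f k)" for f :: "nat \<Rightarrow> real"
          using \<open>1 \<le> n\<close> by (simp add: lessThan_atLeast0 sum.atLeast_Suc_lessThan)
        have h0: "Lp_norm M 2 (h 0) \<le> Lp_norm M 2 u"
          using hn[of 1] norm_nn by (simp add: power2_le_iff_abs_le)
        have "(\<Sum>k=1..<n. (Lp_norm M 2 (h k))\<^sup>2) \<le> (Lp_norm M 2 u)\<^sup>2"
          using hn[of n] unfolding split by (smt (verit) zero_le_power2)
        then have hs: "sqrt (\<Sum>k=1..<n. (Lp_norm M 2 (h k))\<^sup>2) \<le> Lp_norm M 2 u"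
          using norm_nn by (simp add: real_le_lsqrt)
        \<comment> \<open>Cauchy-Schwarz in \<open>k\<close> separates the decay factors, controlled
          by the Gaussian sum, from the norms of the components, controlled by Bessel's
          inequality.\<close>
        have "(\<Sum>k=1..<n. b k * Lp_norm M 2 (h k))
            \<le> L2_set b {1..<n} * L2_set (\<lambda>k. Lp_norm M 2 (h k)) {1..<n}"
          using L2_set_mult_ineq[of b "\<lambda>k. Lp_norm M 2 (h k)" "{1..<n}"] norm_nn
          by (simp add: b_def)
        also have "\<dots> \<le> (sqrt c * T) * Lp_norm M 2 u"
        proof (rule mult_mono)
          show "L2_set b {1..<n} \<le> sqrt c * T"
            using real_sqrt_le_mono[OF sumc[OF t(1), of n]]
            by (simp add: L2_set_def b_def T_def real_sqrt_mult)
        qed (use hs c T in \<open>auto simp: L2_set_def intro!: sum_nonneg\<close>)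
        finally have bs: "(\<Sum>k=1..<n. b k * Lp_norm M 2 (h k)) \<le> sqrt c * T * Lp_norm M 2 u" .
        have "\<bar>P t (S n) x\<bar> \<le> (\<Sum>k<n. \<bar>P t (h k) x\<bar>)" unfolding elim(3) by (rule sum_abs)
        also have "\<dots> \<le> Lp_norm M 2 (h 0) + (\<Sum>k=1..<n. C * b k * Lp_norm M 2 (h k))"
          unfolding split using elim(1,2) by (intro add_mono sum_mono) auto
        also have "\<dots> \<le> T * Lp_norm M 2 u + C * (sqrt c * T * Lp_norm M 2 u)"
        proof (rule add_mono)
          have "1 * Lp_norm M 2 u \<le> T * Lp_norm M 2 u"
            using T norm_nn by (intro mult_right_mono) auto
          then show "Lp_norm M 2 (h 0) \<le> T * Lp_norm M 2 u" using h0 by simp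
          show "(\<Sum>k=1..<n. C * b k * Lp_norm M 2 (h k)) \<le> C * (sqrt c * T * Lp_norm M 2 u)"
            using mult_left_mono[OF bs, of C] C by (simp add: sum_distrib_left mult.assoc)
        qed
        also have "\<dots> = B" by (simp add: B_def algebra_simps)
        finally show ?case .
      qed
    qed
    define I where "I = (\<integral>x. \<bar>g x\<bar> \<partial>M)"
    have I: "0 \<le> I" by (simp add: I_def)
    have gint: "integrable M (\<lambda>x. \<bar>g x\<bar>)"
      using L2_mult_integrable[OF L2_abs[OF g] L2_const[of 1]] by simp
    have bound: "L2_inner M (S n) u \<le> B * I" if n: "1 \<le> n" for n
    proof -
      have "L2_inner M (S n) u = L2_inner M (P t (S n)) g"
        unfolding u_def using t g S by (intro L2_inner_P) auto
      also have "\<dots> \<le> (\<integral>x. B * \<bar>g x\<bar> \<partial>M)"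
        unfolding L2_inner_def
      proof (rule integral_mono_AE)
        show "integrable M (\<lambda>x. P t (S n) x * g x)"
          using S g t by (intro L2_mult_integrable P_L2) auto
        show "integrable M (\<lambda>x. B * \<bar>g x\<bar>)" using gint by simp
        show "AE x in M. P t (S n) x * g x \<le> B * \<bar>g x\<bar>"
          using PS[OF n]
        proof eventually_elim
          case (elim x)
          have "P t (S n) x * g x \<le> \<bar>P t (S n) x\<bar> * \<bar>g x\<bar>" by (simp flip: abs_mult)
          also have "\<dots> \<le> B * \<bar>g x\<bar>" using elim by (intro mult_right_mono) auto
          finally show ?case .
        qed
      qed
      finally show ?thesis by (simp add: I_def)
    qed
    have "(\<lambda>n. L2_inner M (S n) u) \<longlonglongrightarrow> L2_inner M u u"
      using S u lim unfolding S_def by (intro L2_inner_tendsto) auto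
    then have "L2_inner M u u \<le> B * I"
      using bound by (intro LIMSEQ_le_const2) auto
    then have le: "(Lp_norm M 2 u)\<^sup>2 \<le> ((1 + C * sqrt c) * T * I) * Lp_norm M 2 u"
      by (simp add: Lp_norm_2 L2_inner_self_nonneg B_def algebra_simps)
    have "Lp_norm M 2 u \<le> (1 + C * sqrt c) * T * I"
    proof (cases "Lp_norm M 2 u = 0")
      case True
      then show ?thesis using T I C c by simp
    next
      case False
      then have "0 < Lp_norm M 2 u" using norm_nn[of u] by simp
      then show ?thesis using le by (simp add: power2_eq_square)
    qed
    then have "(Lp_norm M 2 u)\<^sup>2 \<le> ((1 + C * sqrt c) * T * I)\<^sup>2"
      using norm_nn by (rule power_mono)
    also have "\<dots> = K * t powr (- (p + 1/2)) * I\<^sup>2"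
      by (simp add: power_mult_distrib K_def T_def)
    finally show ?thesis
      by (simp add: u_def I_def Lp_norm_2 L2_inner_self_nonneg)
  qed
  ultimately show thesis by (rule that)
qed

end

subsection \<open>From the Nash inequality to the Sobolev inequality by truncation\<close>

text \<open>Sum the recursion and bound each \<open>x k\<close> under the power by the whole sum A.
  Half of A is absorbed on the left, so A \<le> 2 + 2 D A^\<beta>; for A > 1 this bounds A^(1 -
  \<beta>) because \<beta> < 1. Below, the weights are the energies of the layers.\<close>

lemma sum_le_of_recursion:
  fixes x w :: "nat \<Rightarrow> real"
  assumes x: "\<And>k. 0 \<le> x k" "x 0 \<le> 1" and w: "\<And>k. 0 \<le> w k" "(\<Sum>k<n. w k) \<le> 1"
    and step: "\<And>k. k < n \<Longrightarrow> x (Suc k) \<le> x k / 2 + D * x k powr \<beta> * w k"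
    and D: "0 \<le> D" and \<beta>: "0 < \<beta>" "\<beta> < 1"
  shows "(\<Sum>k\<le>n. x k) \<le> (2 + 2 * D) powr (1 / (1 - \<beta>))"
proof -
  define A where "A = (\<Sum>k\<le>n. x k)"
  show ?thesis
  proof (cases "A \<le> 1")
    case True
    have "1 \<le> (2 + 2 * D) powr (1 / (1 - \<beta>))"
      using D \<beta> by (intro ge_one_powr_ge_zero) auto
    with True show ?thesis by (simp add: A_def)
  next
    case False
    have A: "A = x 0 + (\<Sum>k<n. x (Suc k))"
      unfolding A_def by (simp add: sum.atMost_shift)
    have xA: "x k \<le> A" if "k \<le> n" for k
      unfolding A_def using that x by (intro member_le_sum) auto
    have "(\<Sum>k<n. x (Suc k)) \<le> (\<Sum>k<n. x k / 2 + D * A powr \<beta> * w k)"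
    proof (rule sum_mono)
      fix k assume k: "k \<in> {..<n}"
      have "x (Suc k) \<le> x k / 2 + D * x k powr \<beta> * w k" using step k by simp
      also have "\<dots> \<le> x k / 2 + D * A powr \<beta> * w k"
        using k x w D \<beta> xA by (intro add_left_mono mult_right_mono mult_left_mono powr_mono2) auto
      finally show "x (Suc k) \<le> x k / 2 + D * A powr \<beta> * w k" .
    qed
    also have "\<dots> = (\<Sum>k<n. x k) / 2 + D * A powr \<beta> * (\<Sum>k<n. w k)"
      by (simp add: sum.distrib sum_distrib_left sum_divide_distrib)
    also have "\<dots> \<le> A / 2 + D * A powr \<beta> * 1"
    proof (intro add_mono divide_right_mono mult_left_mono w)
      show "(\<Sum>k<n. x k) \<le> A" unfolding A_def using x by (intro sum_mono2) auto
    qed (use D in auto)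
    finally have "A \<le> 2 + 2 * D * A powr \<beta>" using A x(2) by linarith
    also have "\<dots> \<le> 2 * A powr \<beta> + 2 * D * A powr \<beta>"
      using False \<beta> ge_one_powr_ge_zero[of A \<beta>] by simp
    finally have "A powr 1 \<le> (2 + 2 * D) * A powr \<beta>"
      using False by (simp add: distrib_right)
    then have "A powr 1 / A powr \<beta> \<le> 2 + 2 * D"
      using False by (simp add: divide_le_eq)
    then have "A powr (1 - \<beta>) \<le> 2 + 2 * D"
      by (simp only: powr_diff)
    then have "(A powr (1 - \<beta>)) powr (1 / (1 - \<beta>)) \<le> (2 + 2 * D) powr (1 / (1 - \<beta>))"
      using \<beta> by (intro powr_mono2) auto
    then show ?thesis using False \<beta> by (simp add: powr_powr flip: A_def)
  qed
qed

text \<open>Doubling the truncation height changes the left side only if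
  \<open>2 ^ n \<le> y\<close>, and then the new summand alone dominates it.\<close>

lemma min_powr_le_dyadic_sum:
  fixes y q :: real
  assumes y: "0 \<le> y" and q: "0 < q"
  shows "min y (2 ^ n) powr q \<le> 1 + (\<Sum>k<n. (2 ^ Suc k) powr q * (if 2 ^ k \<le> y then 1 else 0))"
proof (induction n)
  case 0
  have "min y 1 powr q \<le> 1 powr q" using y q by (intro powr_mono2) auto
  then show ?case by simp
next
  case (Suc n)
  show ?case
  proof (cases "2 ^ n \<le> y")
    case True
    have "min y (2 ^ Suc n) powr q \<le> (2 ^ Suc n) powr q"
      using y q by (intro powr_mono2) auto
    moreover have "0 \<le> (\<Sum>k<n. (2 ^ Suc k) powr q * (if 2 ^ k \<le> y then 1 else 0))"
      by (intro sum_nonneg) auto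
    ultimately show ?thesis using True by simp
  next
    case False
    then have "min y (2 ^ Suc n) = min y (2 ^ n)"
      using zero_less_power[of "2::real" n] unfolding power_Suc by linarith
    then show ?thesis using Suc False by simp
  qed
qed

context symmetric_Markov_semigroup
begin

text \<open>The time \<open>t\<close> is rounded up to a multiple of \<open>s\<close>, as the monotonicity of the forms is known only
  along multiples.\<close>

lemma Nash_inequality:
  assumes ultra: "\<And>t g. 0 < t \<Longrightarrow> t \<le> 1 \<Longrightarrow> g \<in> L2 M \<Longrightarrow>
      L2_inner M (P t g) (P t g) \<le> K * t powr (- r) * (\<integral>x. \<bar>g x\<bar> \<partial>M)\<^sup>2"
    and K: "0 < K" and r: "0 < r" and g: "g \<in> L2 M" and s: "0 < s" "s \<le> t"
  shows "L2_inner M g g \<le> K * 2 powr r * t powr (- r) * (\<integral>x. \<bar>g x\<bar> \<partial>M)\<^sup>2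
    + 2 * t * (approx_form s g g + L2_inner M g g)"
proof (cases "t \<le> 1")
  case False
  \<comment> \<open>For \<open>t > 1\<close> the second term suffices, since
    \<open>2 * t \<ge> 1\<close> and the form is nonnegative.\<close>
  have "1 * L2_inner M g g \<le> 2 * t * (approx_form s g g + L2_inner M g g)"
    using False approx_form_nonneg[OF s(1) g] L2_inner_self_nonneg[of M g]
    by (intro mult_mono) auto
  moreover have "0 \<le> K * 2 powr r * t powr (- r) * (\<integral>x. \<bar>g x\<bar> \<partial>M)\<^sup>2" using K by simp
  ultimately show ?thesis by simp
next
  case True
  have t: "0 < t" using s by simp
  define n where "n = nat \<lceil>t / s\<rceil>"
  have "1 \<le> t / s" using s by simp
  then have n: "0 < n" "t / s \<le> real n" "real n \<le> t / s + 1"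
    by (auto simp: n_def)
  define u where "u = real n * s"
  have "t \<le> u" using n(2) s by (simp add: u_def divide_le_eq)
  have "u \<le> (t / s + 1) * s" unfolding u_def using n(3) s by (intro mult_right_mono) auto
  also have "\<dots> \<le> 2 * t" using s by (simp add: distrib_right)
  finally have u: "t \<le> u" "u \<le> 2 * t" "0 < u" using \<open>t \<le> u\<close> t by auto
  \<comment> \<open>The left side is the squared norm of \<open>P (u / 2) g\<close>, and
    \<open>u / 2 \<le> t \<le> 1\<close> admits the ultracontractive bound.\<close>
  have "L2_inner M (P u g) g \<le> K * (u / 2) powr (- r) * (\<integral>x. \<bar>g x\<bar> \<partial>M)\<^sup>2"
    using ultra[of "u / 2" g] L2_inner_P_self[of u g] u g True by simp
  also have "\<dots> \<le> K * (t / 2) powr (- r) * (\<integral>x. \<bar>g x\<bar> \<partial>M)\<^sup>2"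
    using K u t r by (intro mult_right_mono mult_left_mono powr_mono2') auto
  also have "(t / 2) powr (- r) = 2 powr r * t powr (- r)"
    using t by (simp add: powr_divide powr_minus field_simps)
  finally have 1: "L2_inner M (P u g) g \<le> K * 2 powr r * t powr (- r) * (\<integral>x. \<bar>g x\<bar> \<partial>M)\<^sup>2"
    by (simp add: mult.assoc)
  have "L2_inner M g g = L2_inner M (P u g) g + u * approx_form u g g"
    using u by (simp add: approx_form_def)
  also have "u * approx_form u g g \<le> 2 * t * approx_form s g g"
    using approx_form_multiple_le[OF s(1) g n(1)] u approx_form_nonneg[OF u(3) g]
    by (intro mult_mono) (auto simp: u_def)
  also have "\<dots> \<le> 2 * t * (approx_form s g g + L2_inner M g g)"
    using t L2_inner_self_nonneg[of M g] by (intro mult_left_mono) auto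
  finally show ?thesis using 1 by simp
qed

text \<open>Both sides of the intended inequality are homogeneous, so the energy is normalised to 1.
  The assumption is on the approximating forms for all small times because the proof passes to
  layers of \<open>g\<close> and selects the time only afterwards.\<close>

proposition Sobolev_normalized:
  fixes r K :: real
  assumes ultra: "\<And>t g. 0 < t \<Longrightarrow> t \<le> 1 \<Longrightarrow> g \<in> L2 M \<Longrightarrow>
      L2_inner M (P t g) (P t g) \<le> K * t powr (- r) * (\<integral>x. \<bar>g x\<bar> \<partial>M)\<^sup>2"
    and K: "0 < K" and r: "1 < r"
  defines "q \<equiv> 2 * r / (r - 1)"
  obtains A where "0 < A"
    "\<And>g. g \<in> L2 M \<Longrightarrow> (\<And>t. 0 < t \<Longrightarrow> t \<le> 1 \<Longrightarrow> approx_form t g g + L2_inner M g g \<le> 1) \<Longrightarrow>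
      g \<in> Lp_space M q \<and> (\<integral>x. \<bar>g x\<bar> powr q \<partial>M) \<le> A"
proof -
  \<comment> \<open>The identity \<open>q / r = q - 2\<close> is what fixes \<open>q\<close>: it
    makes the recursion for \<open>x k\<close> below invariant under the dyadic scaling.\<close>
  have q: "0 < q" "q / r = q - 2" using r by (auto simp: q_def field_simps)
  define K' where "K' = K * 2 powr r"
  have K': "0 < K'" using K by (simp add: K'_def)
  define Q :: real where "Q = 2 powr q"
  have Q: "0 < Q" by (simp add: Q_def)
  \<comment> \<open>This is \<open>2 * Q\<close> times the part of the time \<open>T k\<close>,
    chosen below, that is independent of \<open>k\<close>.\<close>
  define D where "D = 2 * Q * (2 * Q * K') powr (1 / r)"
  have D: "0 < D" using Q K' by (simp add: D_def)
  \<comment> \<open>The summand 1 covers the values of \<open>g\<close> up to height 1;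
    \<open>Q\<close> arises since level \<open>k\<close> is charged with
    \<open>(2 ^ Suc k) powr q\<close>.\<close>
  define A where "A = 1 + Q * (2 + 2 * D) powr (1 / (1 - 1 / r))"
  have "0 < A" using Q by (simp add: A_def add_pos_nonneg)
  moreover have "g \<in> Lp_space M q \<and> (\<integral>x. \<bar>g x\<bar> powr q \<partial>M) \<le> A"
    if g: "g \<in> L2 M" and W1: "\<And>t. 0 < t \<Longrightarrow> t \<le> 1 \<Longrightarrow> approx_form t g g + L2_inner M g g \<le> 1" for g
  proof -
    define f where "f = (\<lambda>x. \<bar>g x\<bar>)"
    have f: "f \<in> L2 M" using g by (auto simp: f_def)
    have fnn: "0 \<le> f x" for x by (simp add: f_def)
    define R :: "nat \<Rightarrow> 'a \<Rightarrow> real" where "R k = (\<lambda>x. max (f x - 2 ^ k) 0)" for k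
    define l :: "nat \<Rightarrow> 'a \<Rightarrow> real" where "l k = (\<lambda>x. min (R k x) (2 ^ k))" for k
    have R: "R k \<in> L2 M" for k
      using L2_max_const[OF L2_diff[OF f L2_const]] by (simp add: R_def)
    have l: "l k \<in> L2 M" for k using L2_min_const[OF R[of k]] by (simp add: l_def)
    define W where "W t u = approx_form t u u + L2_inner M u u" for t u
    have Wnn: "0 \<le> W t u" if "0 < t" "u \<in> L2 M" for t u
      using approx_form_nonneg[OF that] L2_inner_self_nonneg[of M u] by (simp add: W_def)
    have Wlayer: "W t (l k) + W t (R (Suc k)) \<le> W t (R k)" if t: "0 < t" for t k
    proof -
      \<comment> \<open>The levels \<open>2 ^ k\<close> and \<open>2 ^ Suc k\<close> differ by
        \<open>2 ^ k\<close>, so cutting \<open>R k\<close> at height \<open>2 ^ k\<close> splits it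
        exactly into \<open>l k\<close> and \<open>R (Suc k)\<close>.\<close>
      have "R (Suc k) y = max (R k y - 2 ^ k) 0" for y
        using zero_less_power[of "2::real" k] unfolding R_def power_Suc by linarith
      then have "R (Suc k) = (\<lambda>x. max (R k x - 2 ^ k) 0)" by blast
      then show ?thesis
        using approx_form_layers[OF t R[of k], of "2 ^ k"] by (simp add: W_def l_def R_def)
    qed
    have Wsum: "(\<Sum>k<n. W t (l k)) \<le> 1" if t: "0 < t" "t \<le> 1" for t n
    proof -
      \<comment> \<open>Telescoping: each cut loses at least the energy of the layer removed, and
        the total energy is at most 1.\<close>
      have "(\<Sum>k<n. W t (l k)) + W t (R n) \<le> W t (R 0)"
      proof (induction n)
        case (Suc n)
        then show ?case using Wlayer[OF t(1), of n] by simp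
      qed simp
      moreover have "W t (R 0) \<le> W t f"
      proof -
        have "(\<lambda>x. min (f x) 1) \<in> L2 M" using f by (rule L2_min_const)
        from Wnn[OF t(1) this] show ?thesis
          using approx_form_layers[OF t(1) f fnn, of 1] by (simp add: W_def R_def)
      qed
      moreover have "W t f \<le> W t g"
        using approx_form_abs_le[OF t(1) g] by (simp add: W_def f_def L2_inner_abs_self)
      moreover have "W t g \<le> 1" using W1 t by (simp add: W_def)
      ultimately show ?thesis using Wnn[OF t(1) R[of n]] by linarith
    qed
    define S where "S k = {x \<in> space M. 2 ^ k \<le> f x}" for k :: nat
    have [measurable]: "f \<in> borel_measurable M" using f by (rule L2_measurable)
    have S [measurable]: "S k \<in> sets M" for k unfolding S_def by measurable
    define \<mu> where "\<mu> k = measure M (S k)" for k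
    have \<mu>: "0 \<le> \<mu> k" "\<mu> k \<le> 1" for k by (auto simp: \<mu>_def)
    have \<mu>_mono: "\<mu> (Suc k) \<le> \<mu> k" for k
      unfolding \<mu>_def
    proof (rule finite_measure_mono)
      have "2 ^ k \<le> y" if "2 ^ Suc k \<le> y" for y :: real
        using that zero_less_power[of "2::real" k] unfolding power_Suc by linarith
      then show "S (Suc k) \<subseteq> S k" unfolding S_def by (auto simp del: power_Suc)
    qed (rule S)
    \<comment> \<open>The layer has its full height \<open>2 ^ k\<close> on \<open>S (Suc k)\<close>
      and vanishes outside \<open>S k\<close>; hence this lower bound for its L^2 norm and the next
      upper bound for its L^1 norm.\<close>
    have lower: "(2 ^ k)\<^sup>2 * \<mu> (Suc k) \<le> L2_inner M (l k) (l k)" for k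
    proof -
      have "(\<integral>x. (2 ^ k)\<^sup>2 * indicator (S (Suc k)) x \<partial>M) \<le> L2_inner M (l k) (l k)"
        unfolding L2_inner_def
      proof (rule integral_mono)
        show "integrable M (\<lambda>x. l k x * l k x)" using l by (intro L2_mult_integrable)
        show "integrable M (\<lambda>x. (2 ^ k)\<^sup>2 * indicator (S (Suc k)) x :: real)"
          by (intro integrable_mult_right integrable_real_indicator) (auto simp: emeasure_eq_measure)
        show "(2 ^ k)\<^sup>2 * indicator (S (Suc k)) x \<le> l k x * l k x" if "x \<in> space M" for x
        proof (cases "x \<in> S (Suc k)")
          case True
          then have "l k x = 2 ^ k" by (auto simp: S_def l_def R_def)
          then show ?thesis using True by (simp add: power2_eq_square)
        qed simp
      qed
      then show ?thesis by (simp add: \<mu>_def)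
    qed
    have upper: "(\<integral>x. \<bar>l k x\<bar> \<partial>M) \<le> 2 ^ k * \<mu> k" for k
    proof -
      have "(\<integral>x. \<bar>l k x\<bar> \<partial>M) \<le> (\<integral>x. 2 ^ k * indicator (S k) x \<partial>M)"
      proof (rule integral_mono)
        show "integrable M (\<lambda>x. \<bar>l k x\<bar>)"
          using L2_mult_integrable[OF L2_abs[OF l[of k]] L2_const[of 1]] by simp
        show "integrable M (\<lambda>x. 2 ^ k * indicator (S k) x :: real)"
          by (intro integrable_mult_right integrable_real_indicator) (auto simp: emeasure_eq_measure)
        show "\<bar>l k x\<bar> \<le> 2 ^ k * indicator (S k) x" if "x \<in> space M" for x
          using that by (cases "x \<in> S k") (auto simp: S_def l_def R_def)
      qed
      then show ?thesis by (simp add: \<mu>_def)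
    qed
    define x where "x k = (2 ^ k) powr q * \<mu> k" for k
    have sum_x: "(\<Sum>k\<le>n. x k) \<le> (2 + 2 * D) powr (1 / (1 - 1 / r))" for n
    proof -
      \<comment> \<open>the time at which the first term of the Nash inequality for \<open>l k\<close> contributes \<open>x k / 2\<close>\<close>
      define T where "T k = (2 * Q * K' * \<mu> k) powr (1 / r)" for k
      \<comment> \<open>A single \<open>s\<close> must serve all layers, because their energies add
        up to at most 1 only for one common form. It has to lie below every \<open>T k\<close> in
        play; the element 1 ensures \<open>s \<le> 1\<close>, and levels of measure zero are
        excluded as their \<open>T k\<close> vanishes.\<close>
      define Y where "Y = insert 1 (T ` {k. k < n \<and> 0 < \<mu> k})"
      define s where "s = Min Y"
      have Y: "finite Y" "Y \<noteq> {}" "\<forall>y\<in>Y. 0 < y"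
        using Q K' by (auto simp: Y_def T_def)
      have "0 < s" unfolding s_def using Y by (simp add: Min_gr_iff)
      moreover have "s \<le> y" if "y \<in> Y" for y
        unfolding s_def using Y(1) that by (rule Min_le)
      ultimately have s: "0 < s" "s \<le> 1" "\<And>k. k < n \<Longrightarrow> 0 < \<mu> k \<Longrightarrow> s \<le> T k"
        by (simp_all add: Y_def)
      show ?thesis
      proof (rule sum_le_of_recursion)
        show "0 \<le> x k" for k using \<mu> by (simp add: x_def)
        show "x 0 \<le> 1" using \<mu> by (simp add: x_def)
        show "0 \<le> W s (l k)" for k using s l by (intro Wnn)
        show "(\<Sum>k<n. W s (l k)) \<le> 1" using s by (intro Wsum)
        show "0 \<le> D" "0 < 1 / r" "1 / r < 1" using D r by auto
        show "x (Suc k) \<le> x k / 2 + D * x k powr (1 / r) * W s (l k)" if k: "k < n" for k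
        proof (cases "\<mu> k = 0")
          case True
          then have "\<mu> (Suc k) = 0" using \<mu>_mono[of k] \<mu>(1)[of "Suc k"] by simp
          then show ?thesis using True by (simp add: x_def)
        next
          case False
          then have \<mu>k: "0 < \<mu> k" using \<mu>(1)[of k] by simp
          define b :: real where "b = 2 ^ k"
          define w where "w = W s (l k)"
          have b: "0 < b" by (simp add: b_def)
          have Tr: "T k powr (- r) = 1 / (2 * Q * K' * \<mu> k)"
            using r Q K' \<mu>k by (simp add: T_def powr_powr powr_minus_divide)
          have "b\<^sup>2 * \<mu> (Suc k) \<le> K' * T k powr (- r) * (\<integral>x. \<bar>l k x\<bar> \<partial>M)\<^sup>2 + 2 * T k * w"
          proof -
            have "0 < r" using r by simp
            from Nash_inequality[OF ultra K this l[of k] s(1) s(3)[OF k \<mu>k]]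
            have "L2_inner M (l k) (l k)
                \<le> K' * T k powr (- r) * (\<integral>x. \<bar>l k x\<bar> \<partial>M)\<^sup>2 + 2 * T k * w"
              by (simp only: K'_def w_def W_def)
            with lower[of k] show ?thesis unfolding b_def by linarith
          qed
          also have "\<dots> \<le> K' * T k powr (- r) * (b * \<mu> k)\<^sup>2 + 2 * T k * w"
            using upper[of k] K' by (intro add_right_mono mult_left_mono power_mono) (auto simp: b_def)
          also have "\<dots> = b\<^sup>2 * (\<mu> k / (2 * Q)) + 2 * T k * w"
            unfolding Tr using K' Q \<mu>k by (simp add: field_simps power2_eq_square)
          finally have "b\<^sup>2 * \<mu> (Suc k) \<le> b\<^sup>2 * (\<mu> k / (2 * Q)) + 2 * T k * w" .
          then have "(b\<^sup>2 * \<mu> (Suc k)) / b\<^sup>2 \<le> (b\<^sup>2 * (\<mu> k / (2 * Q)) + 2 * T k * w) / b\<^sup>2"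
            by (rule divide_right_mono) simp
          then have "\<mu> (Suc k) \<le> \<mu> k / (2 * Q) + 2 * T k * w / b\<^sup>2"
            using b by (simp add: add_divide_distrib)
          \<comment> \<open>Multiplying by \<open>Q * b powr q\<close> turns the left side into
            \<open>x (Suc k)\<close> and the first term on the right into
            \<open>x k / 2\<close>.\<close>
          then have "Q * b powr q * \<mu> (Suc k) \<le> Q * b powr q * (\<mu> k / (2 * Q) + 2 * T k * w / b\<^sup>2)"
            using Q by (intro mult_left_mono) auto
          also have "\<dots> = b powr q * \<mu> k / 2 + 2 * Q * T k * (b powr q / b\<^sup>2) * w"
            using Q b by (simp add: field_simps)
          also have "b powr q / b\<^sup>2 = (b powr q) powr (1 / r)"
            using b q(2) by (simp add: powr_powr powr_diff)
          also have "2 * Q * T k * (b powr q) powr (1 / r) = D * (b powr q * \<mu> k) powr (1 / r)"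
            using Q K' \<mu>k b by (simp add: D_def T_def powr_mult)
          also have "Q * b powr q * \<mu> (Suc k) = x (Suc k)"
            by (simp add: x_def Q_def b_def powr_mult)
          finally show ?thesis by (simp add: x_def w_def b_def)
        qed
      qed
    qed
    have fL: "(\<integral>y. \<bar>min (f y) (2 ^ n)\<bar> powr q \<partial>M) \<le> A"
      "integrable M (\<lambda>y. \<bar>min (f y) (2 ^ n)\<bar> powr q)" for n
    proof -
      let ?F = "\<lambda>y. 1 + (\<Sum>k<n. (2 ^ Suc k) powr q * indicator (S k) y) :: real"
      have Fint: "integrable M ?F"
        by (intro Bochner_Integration.integrable_add Bochner_Integration.integrable_sum
            integrable_mult_right integrable_real_indicator) (auto simp: emeasure_eq_measure)
      have le: "\<bar>min (f y) (2 ^ n)\<bar> powr q \<le> ?F y" if "y \<in> space M" for y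
      proof -
        have "indicator (S k) y = (if 2 ^ k \<le> f y then 1 else 0 :: real)" for k
          using that by (simp add: S_def)
        moreover have "\<bar>min (f y) (2 ^ n)\<bar> = min (f y) (2 ^ n)"
          using fnn[of y] by simp
        ultimately show ?thesis
          using min_powr_le_dyadic_sum[OF fnn[of y] q(1), of n] by (simp only:)
      qed
      show int: "integrable M (\<lambda>y. \<bar>min (f y) (2 ^ n)\<bar> powr q)"
        using le by (intro Bochner_Integration.integrable_bound[OF Fint]) (auto intro!: AE_I2 order_trans[OF le])
      have "(\<integral>y. \<bar>min (f y) (2 ^ n)\<bar> powr q \<partial>M) \<le> (\<integral>y. ?F y \<partial>M)"
        using int Fint le by (rule integral_mono)
      also have "\<dots> = 1 + (\<Sum>k<n. (2 ^ Suc k) powr q * \<mu> k)"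
      proof -
        have "integrable M (\<lambda>y. \<Sum>k<n. (2 ^ Suc k) powr q * indicator (S k) y :: real)"
          by (intro Bochner_Integration.integrable_sum integrable_mult_right integrable_real_indicator)
            (auto simp: emeasure_eq_measure)
        then have "(\<integral>y. ?F y \<partial>M) = (\<integral>y. 1 \<partial>M) + (\<integral>y. (\<Sum>k<n. (2 ^ Suc k) powr q * indicator (S k) y) \<partial>M)"
          by (intro Bochner_Integration.integral_add) auto
        also have "(\<integral>y. (\<Sum>k<n. (2 ^ Suc k) powr q * indicator (S k) y) \<partial>M)
            = (\<Sum>k<n. (\<integral>y. (2 ^ Suc k) powr q * indicator (S k) y \<partial>M))"
          by (intro Bochner_Integration.integral_sum integrable_mult_right integrable_real_indicator)
            (auto simp: emeasure_eq_measure)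
        finally show ?thesis by (simp add: \<mu>_def prob_space)
      qed
      also have "(\<Sum>k<n. (2 ^ Suc k) powr q * \<mu> k) = Q * (\<Sum>k<n. x k)"
        by (simp add: sum_distrib_left x_def Q_def powr_mult mult.assoc)
      also have "(\<Sum>k<n. x k) \<le> (\<Sum>k\<le>n. x k)"
        using \<mu> by (intro sum_mono2) (auto simp: x_def)
      also have "\<dots> \<le> (2 + 2 * D) powr (1 / (1 - 1 / r))" by (rule sum_x)
      finally show "(\<integral>y. \<bar>min (f y) (2 ^ n)\<bar> powr q \<partial>M) \<le> A"
        using Q by (simp add: A_def mult_left_mono)
    qed
    have conv: "(\<lambda>n. min (f y) (2 ^ n)) \<longlonglongrightarrow> f y" for y
    proof -
      obtain N where "f y < 2 ^ N" using real_arch_pow[of 2 "f y"] by auto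
      then have "f y < 2 ^ n" if "N \<le> n" for n
        using power_increasing[OF that, of "2::real"] by linarith
      then have "\<forall>\<^sub>F n in sequentially. min (f y) (2 ^ n) = f y"
        by (intro eventually_sequentiallyI[of N]) (simp add: min_def less_imp_le)
      then show ?thesis by (rule tendsto_eventually)
    qed
    have "f \<in> borel_measurable M" "(\<lambda>y. min (f y) (2 ^ n)) \<in> borel_measurable M" for n
      by measurable
    from Lp_space_bound_liminf[where u = "\<lambda>n y. min (f y) (2 ^ n)", OF this AE_I2[OF conv] q(1)
        less_imp_le[OF \<open>0 < A\<close>] fL(2) fL(1)]
    have "f \<in> Lp_space M q" "(\<integral>y. \<bar>f y\<bar> powr q \<partial>M) \<le> A"
      by blast+
    then show ?thesis
      using L2_measurable[OF g] by (simp add: Lp_space_def f_def)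
  qed
  ultimately show thesis by (rule that)
qed

end

subsection \<open>The Dirichlet form\<close>

lemma Lp_norm_2_cong_AE:
  assumes "AE x in M. f x = g x" "f \<in> L2 M" "g \<in> L2 M"
  shows "Lp_norm M 2 f = Lp_norm M 2 g"
  unfolding Lp_norm_2 using assms by (intro arg_cong[where f = sqrt] L2_inner_cong_AE)

context symmetric_Markov_semigroup
begin

lemma is_generator_value_generator:
  assumes "f \<in> generator_domain M P"
  shows "is_generator_value M P f (generator M P f)"
  using assms unfolding generator_domain_def generator_def
  using someI[of "is_generator_value M P f"] by blast

lemma generator_L2: "f \<in> generator_domain M P \<Longrightarrow> generator M P f \<in> L2 M"
  using is_generator_value_generator by (simp add: is_generator_value_def)

lemma generator_domain_L2: "f \<in> generator_domain M P \<Longrightarrow> f \<in> L2 M"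
  by (simp add: generator_domain_def)

lemma difference_quotient_L2:
  assumes "0 \<le> t" "f \<in> L2 M"
  shows "(\<lambda>x. (P t f x - f x) / t) \<in> L2 M"
  using L2_scale[OF L2_diff[OF P_L2[OF assms] assms(2)], of "1 / t"] by simp

lemma approx_form_tendsto:
  assumes f: "f \<in> generator_domain M P" and g: "g \<in> L2 M"
  shows "((\<lambda>t. approx_form t f g) \<longlongrightarrow> - L2_inner M (generator M P f) g) (at_right 0)"
proof -
  have fL: "f \<in> L2 M" using f by (rule generator_domain_L2)
  have "((\<lambda>t. L2_inner M (\<lambda>x. (P t f x - f x) / t) g) \<longlongrightarrow> L2_inner M (generator M P f) g) (at_right 0)"
  proof (rule L2_inner_tendsto)
    show "\<forall>\<^sub>F t in at_right 0. (\<lambda>x. (P t f x - f x) / t) \<in> L2 M"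
      using fL by (auto simp: eventually_at_filter intro!: always_eventually difference_quotient_L2)
    show "((\<lambda>t. Lp_norm M 2 (\<lambda>x. (P t f x - f x) / t - generator M P f x)) \<longlongrightarrow> 0) (at_right 0)"
      using is_generator_value_generator[OF f] by (simp add: is_generator_value_def)
  qed (use f g in \<open>auto intro: generator_L2\<close>)
  then have "((\<lambda>t. - L2_inner M (\<lambda>x. (P t f x - f x) / t) g)
      \<longlongrightarrow> - L2_inner M (generator M P f) g) (at_right 0)"
    by (rule tendsto_minus)
  moreover have "\<forall>\<^sub>F t in at_right 0. - L2_inner M (\<lambda>x. (P t f x - f x) / t) g = approx_form t f g"
  proof (rule eventually_at_right_less[THEN eventually_mono])
    fix t :: real assume t: "0 < t"
    have "L2_inner M (\<lambda>x. 1 / t * (P t f x - f x)) g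
        = 1 / t * (L2_inner M (P t f) g - L2_inner M f g)"
      using fL g t by (simp only: L2_inner_scale_left) (simp add: L2_inner_diff_left P_L2)
    then show "- L2_inner M (\<lambda>x. (P t f x - f x) / t) g = approx_form t f g"
      by (simp add: approx_form_def diff_divide_distrib)
  qed
  ultimately show ?thesis by (simp only: tendsto_cong)
qed

lemma approx_form_self_tendsto:
  assumes "f \<in> generator_domain M P"
  shows "((\<lambda>t. approx_form t f f) \<longlongrightarrow> generator_form M P f) (at_right 0)"
proof -
  have "generator_form M P f = - L2_inner M (generator M P f) f"
    by (simp add: generator_form_def L2_inner_def mult.commute)
  then show ?thesis using approx_form_tendsto[OF assms generator_domain_L2[OF assms]] by simp
qed

text \<open>The Cauchy condition in \<open>form_approximates\<close> concerns differences, and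
  \<open>generator\<close> is an arbitrary choice outside its domain. Differences therefore have to
  stay in the domain.\<close>

lemma generator_domain_diff:
  assumes f: "f \<in> generator_domain M P" and g: "g \<in> generator_domain M P"
  shows "(\<lambda>x. f x - g x) \<in> generator_domain M P"
proof -
  have fL: "f \<in> L2 M" "g \<in> L2 M" using f g by (auto intro: generator_domain_L2)
  have gL: "generator M P f \<in> L2 M" "generator M P g \<in> L2 M" using f g by (auto intro: generator_L2)
  define q where "q t f = (\<lambda>x. (P t f x - f x) / t - generator M P f x)" for t f
  have lim: "((\<lambda>t. Lp_norm M 2 (q t f)) \<longlongrightarrow> 0) (at_right 0)" "((\<lambda>t. Lp_norm M 2 (q t g)) \<longlongrightarrow> 0) (at_right 0)"
    using is_generator_value_generator[OF f] is_generator_value_generator[OF g]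
    by (auto simp: is_generator_value_def q_def)
  let ?d = "\<lambda>t x. (P t (\<lambda>x. f x - g x) x - (f x - g x)) / t - (generator M P f x - generator M P g x)"
  have "((\<lambda>t. Lp_norm M 2 (?d t)) \<longlongrightarrow> 0) (at_right 0)"
  proof (rule Lim_null_comparison)
    show "\<forall>\<^sub>F t in at_right 0. norm (Lp_norm M 2 (?d t)) \<le> Lp_norm M 2 (q t f) + Lp_norm M 2 (q t g)"
    proof (rule eventually_at_right_less[THEN eventually_mono])
      fix t :: real assume t: "0 < t"
      have qL: "q t f \<in> L2 M" "q t g \<in> L2 M"
        unfolding q_def using t fL gL by (auto intro!: difference_quotient_L2)
      have qm: "(\<lambda>x. (-1) * q t g x) \<in> L2 M" using qL(2) by (rule L2_scale)
      have "Lp_norm M 2 (?d t) = Lp_norm M 2 (\<lambda>x. q t f x + (-1) * q t g x)"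
      proof (rule Lp_norm_2_cong_AE)
        show "AE x in M. ?d t x = q t f x + (-1) * q t g x"
          using P_diff[of t f g] t fL
          by (auto simp: q_def diff_divide_distrib elim: eventually_mono)
        show "?d t \<in> L2 M" using t fL gL
          by (intro L2_diff difference_quotient_L2[of t "\<lambda>x. f x - g x"]) auto
        show "(\<lambda>x. q t f x + (-1) * q t g x) \<in> L2 M" using qL qm by (intro L2_add)
      qed
      also have "\<dots> \<le> Lp_norm M 2 (q t f) + Lp_norm M 2 (\<lambda>x. (-1) * q t g x)"
        using qL qm by (intro Lp_norm_2_triangle)
      also have "Lp_norm M 2 (\<lambda>x. (-1) * q t g x) = Lp_norm M 2 (q t g)"
        by (simp only: Lp_norm_2_scale abs_minus_cancel abs_one mult_1_left)
      finally show "norm (Lp_norm M 2 (?d t)) \<le> Lp_norm M 2 (q t f) + Lp_norm M 2 (q t g)"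
        by (simp add: Lp_norm_2 L2_inner_self_nonneg)
    qed
    show "((\<lambda>t. Lp_norm M 2 (q t f) + Lp_norm M 2 (q t g)) \<longlongrightarrow> 0) (at_right 0)"
      using tendsto_add[OF lim] by simp
  qed
  then have "is_generator_value M P (\<lambda>x. f x - g x) (\<lambda>x. generator M P f x - generator M P g x)"
    using gL by (auto simp: is_generator_value_def)
  then show ?thesis using fL by (auto simp: generator_domain_def)
qed

lemma generator_form_nonneg:
  assumes f: "f \<in> generator_domain M P"
  shows "0 \<le> generator_form M P f"
proof (rule tendsto_lowerbound[OF approx_form_self_tendsto[OF f]])
  show "\<forall>\<^sub>F t in at_right 0. 0 \<le> approx_form t f f"
    using f by (auto intro!: eventually_at_right_less[THEN eventually_mono] approx_form_nonneg generator_domain_L2)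
qed simp

text \<open>Obtained as the limit of the identity for the bilinear approximating forms, so that the
  representatives chosen by \<open>generator\<close> need not be compared.\<close>

lemma generator_form_diff:
  assumes f: "f \<in> generator_domain M P" and g: "g \<in> generator_domain M P"
  shows "generator_form M P (\<lambda>x. f x - g x)
    = generator_form M P f + 2 * L2_inner M (generator M P f) g + generator_form M P g"
proof (rule tendsto_unique[OF _ approx_form_self_tendsto[OF generator_domain_diff[OF f g]]])
  have fL: "f \<in> L2 M" "g \<in> L2 M" using f g by (auto intro: generator_domain_L2)
  have "((\<lambda>t. approx_form t f f - 2 * approx_form t f g + approx_form t g g) \<longlongrightarrow>
      generator_form M P f - 2 * (- L2_inner M (generator M P f) g) + generator_form M P g) (at_right 0)"
    using f g fL by (intro tendsto_intros approx_form_self_tendsto approx_form_tendsto)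
  moreover have "\<forall>\<^sub>F t in at_right 0. approx_form t f f - 2 * approx_form t f g + approx_form t g g
      = approx_form t (\<lambda>x. f x - g x) (\<lambda>x. f x - g x)"
    using fL by (auto intro!: eventually_at_right_less[THEN eventually_mono] simp: approx_form_diff_self)
  ultimately show "((\<lambda>t. approx_form t (\<lambda>x. f x - g x) (\<lambda>x. f x - g x)) \<longlongrightarrow>
      generator_form M P f + 2 * L2_inner M (generator M P f) g + generator_form M P g) (at_right 0)"
    by (simp add: tendsto_cong)
qed simp

text \<open>\<open>t\<close> is a multiple of \<open>t / real (Suc n)\<close>, so the form at time
  \<open>t\<close> lies below the forms at these times, which converge to the form of the
  generator.\<close>

lemma approx_form_le_generator_form:
  assumes t: "0 < t" and f: "f \<in> generator_domain M P"
  shows "approx_form t f f \<le> generator_form M P f"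
proof -
  have "filterlim (\<lambda>n. t / real (Suc n)) (at_right 0) sequentially"
    using t by real_asymp
  then have "(\<lambda>n. approx_form (t / real (Suc n)) f f) \<longlonglongrightarrow> generator_form M P f"
    by (rule filterlim_compose[OF approx_form_self_tendsto[OF f]])
  moreover have "approx_form t f f \<le> approx_form (t / real (Suc n)) f f" for n
    using approx_form_multiple_le[of "t / real (Suc n)" f "Suc n"] t f
    by (simp add: generator_domain_L2)
  ultimately show ?thesis by (intro LIMSEQ_le_const) auto
qed

lemma approx_form_Cauchy_Schwarz:
  assumes t: "0 < t" and f: "f \<in> L2 M" and g: "g \<in> L2 M"
  shows "(approx_form t f g)\<^sup>2 \<le> approx_form t f f * approx_form t g g"
proof (rule quadratic_nonneg_imp_discrim_le)
  fix s :: real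
  have sg: "(\<lambda>x. s * g x) \<in> L2 M" using g by auto
  have "0 \<le> approx_form t (\<lambda>x. f x - s * g x) (\<lambda>x. f x - s * g x)"
    using f sg by (intro approx_form_nonneg t L2_diff)
  also have "\<dots> = approx_form t f f - 2 * s * approx_form t f g + s\<^sup>2 * approx_form t g g"
    using t f g sg by (simp add: approx_form_diff_self approx_form_scale_left approx_form_scale_right
        power2_eq_square)
  finally show "0 \<le> approx_form t f f - 2 * s * approx_form t f g + s\<^sup>2 * approx_form t g g" .
qed (rule approx_form_nonneg[OF t g])

text \<open>The reverse triangle inequality for the energy seminorm, inherited from the
  approximating forms. It turns the Cauchy condition into convergence of the energies.\<close>

lemma sqrt_generator_form_diff_le:
  assumes f: "f \<in> generator_domain M P" and g: "g \<in> generator_domain M P"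
  shows "(sqrt (generator_form M P f) - sqrt (generator_form M P g))\<^sup>2
    \<le> generator_form M P (\<lambda>x. f x - g x)"
proof (rule tendsto_le[OF _ approx_form_self_tendsto[OF generator_domain_diff[OF f g]]])
  show "((\<lambda>t. (sqrt (approx_form t f f) - sqrt (approx_form t g g))\<^sup>2) \<longlongrightarrow>
      (sqrt (generator_form M P f) - sqrt (generator_form M P g))\<^sup>2) (at_right 0)"
    using f g by (intro tendsto_intros approx_form_self_tendsto)
  have fL: "f \<in> L2 M" "g \<in> L2 M" using f g by (auto intro: generator_domain_L2)
  show "\<forall>\<^sub>F t in at_right 0. (sqrt (approx_form t f f) - sqrt (approx_form t g g))\<^sup>2
      \<le> approx_form t (\<lambda>x. f x - g x) (\<lambda>x. f x - g x)"
  proof (rule eventually_at_right_less[THEN eventually_mono])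
    fix t :: real assume t: "0 < t"
    have "approx_form t f g \<le> sqrt (approx_form t f f) * sqrt (approx_form t g g)"
      using real_le_rsqrt[OF approx_form_Cauchy_Schwarz[OF t fL]] by (simp add: real_sqrt_mult)
    then show "(sqrt (approx_form t f f) - sqrt (approx_form t g g))\<^sup>2
        \<le> approx_form t (\<lambda>x. f x - g x) (\<lambda>x. f x - g x)"
      using t fL by (simp add: approx_form_diff_self power2_diff approx_form_nonneg)
  qed
qed simp

text \<open>Half of the parallelogram law. Nonnegativity at the sum of \<open>f\<close> and
  \<open>g\<close> is used for the approximating forms and carried to the limit.\<close>

lemma generator_form_diff_le:
  assumes f: "f \<in> generator_domain M P" and g: "g \<in> generator_domain M P"
  shows "generator_form M P (\<lambda>x. f x - g x) \<le> 2 * generator_form M P f + 2 * generator_form M P g"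
proof -
  have "0 \<le> generator_form M P f - 2 * L2_inner M (generator M P f) g + generator_form M P g"
  proof (rule tendsto_lowerbound)
    have fL: "f \<in> L2 M" "g \<in> L2 M" using f g by (auto intro: generator_domain_L2)
    show "((\<lambda>t. approx_form t f f + 2 * approx_form t f g + approx_form t g g) \<longlongrightarrow>
        generator_form M P f - 2 * L2_inner M (generator M P f) g + generator_form M P g) (at_right 0)"
      using tendsto_add[OF tendsto_add[OF approx_form_self_tendsto[OF f]
            tendsto_mult_left[OF approx_form_tendsto[OF f fL(2)], of 2]] approx_form_self_tendsto[OF g]]
      by simp
    show "\<forall>\<^sub>F t in at_right 0. 0 \<le> approx_form t f f + 2 * approx_form t f g + approx_form t g g"
    proof (rule eventually_at_right_less[THEN eventually_mono])
      fix t :: real assume t: "0 < t"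
      show "0 \<le> approx_form t f f + 2 * approx_form t f g + approx_form t g g"
        using approx_form_nonneg[OF t L2_add[OF fL]] approx_form_add_self[of t f g] t fL by simp
    qed
  qed simp
  then show ?thesis using generator_form_diff[OF f g] by simp
qed

text \<open>Closability: \<open>generator_form (w n) \<le> generator_form (w n - w m) + 2 \<langle>- L (w n), w m\<rangle>\<close>, and
  the last term vanishes as \<open>m\<close> tends to infinity.\<close>

lemma generator_form_closable:
  assumes "form_approximates M P w (\<lambda>_. 0)"
  shows "(\<lambda>n. generator_form M P (w n)) \<longlonglongrightarrow> 0"
proof (rule LIMSEQ_I)
  fix e :: real assume e: "0 < e"
  have w: "w n \<in> generator_domain M P" for n
    using assms by (simp add: form_approximates_def)
  have wL: "w n \<in> L2 M" for n using w by (rule generator_domain_L2)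
  have w0: "(\<lambda>n. Lp_norm M 2 (\<lambda>x. w n x - 0)) \<longlonglongrightarrow> 0"
    using assms by (simp add: form_approximates_def)
  have "0 < e / 2" using e by simp
  then obtain N where N: "\<And>m n. N \<le> m \<Longrightarrow> N \<le> n \<Longrightarrow> generator_form M P (\<lambda>x. w m x - w n x) < e / 2"
    using assms unfolding form_approximates_def by blast
  have "generator_form M P (w n) \<le> e / 2" if n: "N \<le> n" for n
  proof (rule LIMSEQ_le_const)
    have "(\<lambda>m. L2_inner M (w m) (generator M P (w n))) \<longlonglongrightarrow> L2_inner M (\<lambda>_. 0) (generator M P (w n))"
      using wL w0 generator_L2[OF w] L2_const[of 0] by (intro L2_inner_tendsto) auto
    then have "(\<lambda>m. L2_inner M (generator M P (w n)) (w m)) \<longlonglongrightarrow> 0"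
      unfolding L2_inner_commute[of M "generator M P (w n)"] by (simp add: L2_inner_def[of M "\<lambda>_. 0"])
    from tendsto_diff[OF tendsto_const[of "e / 2"] tendsto_mult_left[OF this, of 2]]
    show "(\<lambda>m. e / 2 - 2 * L2_inner M (generator M P (w n)) (w m)) \<longlonglongrightarrow> e / 2" by simp
    show "\<exists>K. \<forall>m\<ge>K. generator_form M P (w n) \<le> e / 2 - 2 * L2_inner M (generator M P (w n)) (w m)"
    proof (intro exI allI impI)
      fix m assume "N \<le> m"
      then show "generator_form M P (w n) \<le> e / 2 - 2 * L2_inner M (generator M P (w n)) (w m)"
        using N[OF n, of m] generator_form_diff[OF w w, of n m] generator_form_nonneg[OF w, of m] by simp
    qed
  qed
  then have "norm (generator_form M P (w n) - 0) < e" if "N \<le> n" for n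
    using e generator_form_nonneg[OF w, of n] that by fastforce
  then show "\<exists>no. \<forall>n\<ge>no. norm (generator_form M P (w n) - 0) < e"
    by blast
qed

lemma form_approximates_generator_form_convergent:
  assumes "form_approximates M P u f"
  shows "convergent (\<lambda>n. generator_form M P (u n))"
proof -
  have u: "u n \<in> generator_domain M P" for n
    using assms by (simp add: form_approximates_def)
  have "Cauchy (\<lambda>n. sqrt (generator_form M P (u n)))"
  proof (rule metric_CauchyI)
    fix e :: real assume e: "0 < e"
    then have "0 < e\<^sup>2" by simp
    then obtain N where N: "\<And>m n. N \<le> m \<Longrightarrow> N \<le> n \<Longrightarrow> generator_form M P (\<lambda>x. u m x - u n x) < e\<^sup>2"
      using assms unfolding form_approximates_def by blast
    have "dist (sqrt (generator_form M P (u m))) (sqrt (generator_form M P (u n))) < e"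
      if "N \<le> m" "N \<le> n" for m n
    proof -
      have "(sqrt (generator_form M P (u m)) - sqrt (generator_form M P (u n)))\<^sup>2 < e\<^sup>2"
        using sqrt_generator_form_diff_le[OF u u, of m n] N[OF that] by simp
      then show ?thesis
        using e power_less_imp_less_base[of "\<bar>sqrt (generator_form M P (u m)) - sqrt (generator_form M P (u n))\<bar>" 2 e]
        by (simp add: dist_real_def)
    qed
    then show "\<exists>N. \<forall>m\<ge>N. \<forall>n\<ge>N. dist (sqrt (generator_form M P (u m))) (sqrt (generator_form M P (u n))) < e"
      by blast
  qed
  then obtain l where "(\<lambda>n. sqrt (generator_form M P (u n))) \<longlonglongrightarrow> l"
    by (auto simp: Cauchy_convergent_iff convergent_def)
  from tendsto_power[OF this, of 2] have "(\<lambda>n. generator_form M P (u n)) \<longlonglongrightarrow> l\<^sup>2"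
    using generator_form_nonneg[OF u] by simp
  then show ?thesis by (auto simp: convergent_def)
qed

text \<open>The difference of two approximating sequences approximates zero, so its energy vanishes
  in the limit by closability, and the reverse triangle inequality identifies the two
  limits.\<close>

lemma form_approximates_limit_unique:
  assumes f: "f \<in> L2 M" and u: "form_approximates M P u f" and v: "form_approximates M P v f"
    and ul: "(\<lambda>n. generator_form M P (u n)) \<longlonglongrightarrow> a" and vl: "(\<lambda>n. generator_form M P (v n)) \<longlonglongrightarrow> b"
  shows "a = b"
proof -
  have ud: "u n \<in> generator_domain M P" and vd: "v n \<in> generator_domain M P" for n
    using u v by (auto simp: form_approximates_def)
  have uL: "u n \<in> L2 M" and vL: "v n \<in> L2 M" for n
    using ud vd by (auto intro: generator_domain_L2)
  define w where "w n = (\<lambda>x. u n x - v n x)" for n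
  have "form_approximates M P w (\<lambda>_. 0)"
    unfolding form_approximates_def
  proof (intro conjI allI impI)
    show "w n \<in> generator_domain M P" for n
      unfolding w_def using ud vd by (rule generator_domain_diff)
    show "(\<lambda>n. Lp_norm M 2 (\<lambda>x. w n x - 0)) \<longlonglongrightarrow> 0"
    proof (rule Lim_null_comparison)
      show "\<forall>\<^sub>F n in sequentially. norm (Lp_norm M 2 (\<lambda>x. w n x - 0))
          \<le> Lp_norm M 2 (\<lambda>x. u n x - f x) + Lp_norm M 2 (\<lambda>x. v n x - f x)"
      proof (intro always_eventually allI)
        fix n
        have "Lp_norm M 2 (\<lambda>x. (u n x - f x) + (-1) * (v n x - f x))
            \<le> Lp_norm M 2 (\<lambda>x. u n x - f x) + Lp_norm M 2 (\<lambda>x. (-1) * (v n x - f x))"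
          using uL vL f by (intro Lp_norm_2_triangle L2_scale L2_diff)
        then show "norm (Lp_norm M 2 (\<lambda>x. w n x - 0))
            \<le> Lp_norm M 2 (\<lambda>x. u n x - f x) + Lp_norm M 2 (\<lambda>x. v n x - f x)"
          unfolding Lp_norm_2_scale by (simp add: w_def Lp_norm_2 L2_inner_self_nonneg)
      qed
      show "(\<lambda>n. Lp_norm M 2 (\<lambda>x. u n x - f x) + Lp_norm M 2 (\<lambda>x. v n x - f x)) \<longlonglongrightarrow> 0"
        using u v tendsto_add[of "\<lambda>n. Lp_norm M 2 (\<lambda>x. u n x - f x)" 0 sequentially
            "\<lambda>n. Lp_norm M 2 (\<lambda>x. v n x - f x)" 0]
        by (simp add: form_approximates_def)
    qed
    fix e :: real assume "0 < e"
    \<comment> \<open>A quarter each, because \<open>generator_form_diff_le\<close> doubles both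
      energies.\<close>
    then have e: "0 < e / 4" by simp
    obtain N1 where N1: "\<And>m n. N1 \<le> m \<Longrightarrow> N1 \<le> n \<Longrightarrow> generator_form M P (\<lambda>x. u m x - u n x) < e / 4"
      using u e unfolding form_approximates_def by blast
    obtain N2 where N2: "\<And>m n. N2 \<le> m \<Longrightarrow> N2 \<le> n \<Longrightarrow> generator_form M P (\<lambda>x. v m x - v n x) < e / 4"
      using v e unfolding form_approximates_def by blast
    show "\<exists>N. \<forall>m\<ge>N. \<forall>n\<ge>N. generator_form M P (\<lambda>x. w m x - w n x) < e"
    proof (intro exI[of _ "max N1 N2"] allI impI)
      fix m n assume mn: "max N1 N2 \<le> m" "max N1 N2 \<le> n"
      have "(\<lambda>x. w m x - w n x) = (\<lambda>x. (u m x - u n x) - (v m x - v n x))"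
        by (auto simp: w_def)
      then show "generator_form M P (\<lambda>x. w m x - w n x) < e"
        using generator_form_diff_le[OF generator_domain_diff[OF ud ud, of m n]
            generator_domain_diff[OF vd vd, of m n]] N1[of m n] N2[of m n] mn by simp
    qed
  qed
  then have w0: "(\<lambda>n. generator_form M P (w n)) \<longlonglongrightarrow> 0" by (rule generator_form_closable)
  have "(\<lambda>n. (sqrt (generator_form M P (u n)) - sqrt (generator_form M P (v n)))\<^sup>2)
      \<longlonglongrightarrow> (sqrt a - sqrt b)\<^sup>2"
    by (intro tendsto_intros ul vl)
  then have "(sqrt a - sqrt b)\<^sup>2 \<le> 0"
    using w0 sqrt_generator_form_diff_le[OF ud vd]
    by (intro LIMSEQ_le[of _ _ "\<lambda>n. generator_form M P (w n)"]) (auto simp: w_def)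
  then show ?thesis by simp
qed

text \<open>Existence and uniqueness of the limit together justify the definite description in
  \<open>Dirichlet_form\<close>.\<close>

lemma Dirichlet_form_tendsto:
  assumes f: "f \<in> L2 M" and u: "form_approximates M P u f"
  shows "(\<lambda>n. generator_form M P (u n)) \<longlonglongrightarrow> Dirichlet_form M P f"
proof -
  obtain e where e: "(\<lambda>n. generator_form M P (u n)) \<longlonglongrightarrow> e"
    using form_approximates_generator_form_convergent[OF u] by (auto simp: convergent_def)
  have "Dirichlet_form M P f = e"
    unfolding Dirichlet_form_def
  proof (rule the_equality)
    show "\<exists>u. form_approximates M P u f \<and> (\<lambda>n. generator_form M P (u n)) \<longlonglongrightarrow> e"
      using u e by blast
    fix e' assume "\<exists>u. form_approximates M P u f \<and> (\<lambda>n. generator_form M P (u n)) \<longlonglongrightarrow> e'"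
    then obtain v where "form_approximates M P v f" "(\<lambda>n. generator_form M P (v n)) \<longlonglongrightarrow> e'"
      by blast
    then show "e' = e" using form_approximates_limit_unique[OF f _ u _ e] by blast
  qed
  with e show ?thesis by simp
qed

text \<open>The constant sequence approximates \<open>f\<close>: its differences are identically
  zero, and the factor 0 in the integrand makes their energy 0. This makes the Poincare inequality
  available on the domain of the generator.\<close>

lemma generator_domain_Dirichlet:
  assumes f: "f \<in> generator_domain M P"
  shows "f \<in> Dirichlet_domain M P" "Dirichlet_form M P f = generator_form M P f"
proof -
  have fL: "f \<in> L2 M" using f by (rule generator_domain_L2)
  have ap: "form_approximates M P (\<lambda>_. f) f"
    using f by (auto simp: form_approximates_def generator_form_def Lp_norm_2 L2_inner_def)
  then show "f \<in> Dirichlet_domain M P" using fL by (auto simp: Dirichlet_domain_def)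
  show "Dirichlet_form M P f = generator_form M P f"
    using Dirichlet_form_tendsto[OF fL ap] by (simp add: LIMSEQ_const_iff)
qed

end

subsection \<open>Tightening\<close>

lemma exp_le_quadratic:
  fixes y :: real
  assumes "\<bar>y\<bar> \<le> 1"
  shows "exp y \<le> 1 + y + y\<^sup>2"
proof (cases "0 \<le> y")
  case True
  then show ?thesis using assms by (intro exp_bound) auto
next
  case False
  define z where "z = - y"
  have z: "0 \<le> z" using False by (simp add: z_def)
  \<comment> \<open>For negative arguments, multiply the claim by \<open>exp z\<close> and replace
    \<open>exp z\<close> by its quadratic Taylor polynomial; the product exceeds 1 by nonnegative
    terms.\<close>
  have "1 \<le> 1 + (z\<^sup>2 + z ^ 3 + z ^ 4) / 2" using z by simp
  also have "\<dots> = (1 + z + z\<^sup>2 / 2) * (1 - z + z\<^sup>2)"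
    by (simp add: field_simps power2_eq_square power3_eq_cube power4_eq_xxxx)
  also have "\<dots> \<le> exp z * (1 - z + z\<^sup>2)"
  proof (rule mult_right_mono[OF exp_lower_Taylor_quadratic[OF z]])
    have "0 \<le> (z - 1 / 2)\<^sup>2 + 3 / 4" by simp
    also have "\<dots> = 1 - z + z\<^sup>2" by (simp add: power2_diff field_simps power2_eq_square)
    finally show "0 \<le> 1 - z + z\<^sup>2" .
  qed
  finally have "exp (- z) * 1 \<le> exp (- z) * (exp z * (1 - z + z\<^sup>2))"
    by (intro mult_left_mono) auto
  then show ?thesis by (simp add: z_def mult.assoc[symmetric] exp_minus)
qed

text \<open>The linear term keeps its exact coefficient because it integrates to zero for centred
  functions. For small \<open>q * x\<close> use 1 + x \<le> exp x and the quadratic bound; otherwise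
  \<open>\<bar>x\<bar> powr q\<close> dominates.\<close>

lemma abs_one_plus_powr_le:
  fixes x q :: real
  assumes q: "1 \<le> q"
  shows "\<bar>1 + x\<bar> powr q \<le> 1 + q * x + (q\<^sup>2 + (q + 1) powr q) * (x\<^sup>2 + \<bar>x\<bar> powr q)"
proof -
  define c where "c = (q + 1) powr q"
  have c: "0 \<le> c" by (simp add: c_def)
  have rhs: "1 + q * x + q\<^sup>2 * x\<^sup>2 + c * \<bar>x\<bar> powr q
      \<le> 1 + q * x + (q\<^sup>2 + c) * (x\<^sup>2 + \<bar>x\<bar> powr q)"
    using c by (simp add: algebra_simps)
  show ?thesis
  proof (cases "\<bar>q * x\<bar> \<le> 1")
    case True
    have "\<bar>x\<bar> \<le> \<bar>q * x\<bar>" using q mult_right_mono[of 1 q "\<bar>x\<bar>"] by (simp add: abs_mult)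
    then have x: "\<bar>x\<bar> \<le> 1" using True by simp
    have "\<bar>1 + x\<bar> powr q \<le> exp x powr q"
      using x q exp_ge_add_one_self[of x] by (intro powr_mono2) auto
    also have "\<dots> = exp (q * x)" by (simp add: powr_def)
    also have "\<dots> \<le> 1 + q * x + (q * x)\<^sup>2" by (rule exp_le_quadratic[OF True])
    also have "\<dots> \<le> 1 + q * x + q\<^sup>2 * x\<^sup>2 + c * \<bar>x\<bar> powr q"
      using c by (simp add: power_mult_distrib)
    finally show ?thesis using rhs unfolding c_def by simp
  next
    case False
    have "\<bar>1 + x\<bar> \<le> 1 + \<bar>x\<bar>" by (rule order_trans[OF abs_triangle_ineq]) simp
    also have "\<dots> \<le> (q + 1) * \<bar>x\<bar>" using False q by (simp add: abs_mult algebra_simps)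
    finally have "\<bar>1 + x\<bar> powr q \<le> ((q + 1) * \<bar>x\<bar>) powr q" using q by (intro powr_mono2) auto
    also have "\<dots> = c * \<bar>x\<bar> powr q" using q by (simp add: powr_mult c_def)
    also have "\<dots> \<le> 1 + q * x + q\<^sup>2 * x\<^sup>2 + c * \<bar>x\<bar> powr q"
    proof -
      \<comment> \<open>The linear term may be negative here; \<open>\<bar>q * x\<bar> > 1\<close>
        lets the quadratic term compensate it.\<close>
      have "\<bar>q * x\<bar> * 1 \<le> \<bar>q * x\<bar> * \<bar>q * x\<bar>" using False by (intro mult_left_mono) auto
      then have "- (q * x) \<le> q\<^sup>2 * x\<^sup>2"
        by (simp add: power2_eq_square algebra_simps flip: abs_mult)
      then show ?thesis by simp
    qed
    finally show ?thesis using rhs unfolding c_def by simp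
  qed
qed

section \<open>L^q norms of a constant plus a centred function\<close>

context prob_space
begin

lemma Lp_add_const:
  assumes y: "y \<in> Lp_space M q" and q: "0 < q"
  shows "integrable M (\<lambda>x. \<bar>c + y x\<bar> powr q)"
proof (rule Bochner_Integration.integrable_bound)
  show "integrable M (\<lambda>x. (2 * \<bar>c\<bar>) powr q + 2 powr q * \<bar>y x\<bar> powr q)"
    using y by (simp add: Lp_space_def)
  show "(\<lambda>x. \<bar>c + y x\<bar> powr q) \<in> borel_measurable M"
    using y by (auto simp: Lp_space_def)
  have "\<bar>c + z\<bar> powr q \<le> (2 * \<bar>c\<bar>) powr q + 2 powr q * \<bar>z\<bar> powr q" for z
  proof -
    have "\<bar>c + z\<bar> powr q \<le> max (2 * \<bar>c\<bar>) (2 * \<bar>z\<bar>) powr q"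
      using q by (intro powr_mono2) auto
    also have "\<dots> \<le> (2 * \<bar>c\<bar>) powr q + (2 * \<bar>z\<bar>) powr q"
      by (simp add: max_def)
    finally show ?thesis by (simp add: powr_mult)
  qed
  then show "AE x in M. norm (\<bar>c + y x\<bar> powr q)
      \<le> norm ((2 * \<bar>c\<bar>) powr q + 2 powr q * \<bar>y x\<bar> powr q)"
    by (auto simp: add_nonneg_nonneg)
qed

text \<open>Integrating the pointwise bound removes the linear term, so the deviation from 1 is
  quadratic in \<open>N\<close> for small \<open>N\<close>. This is why the constant in front of the
  mean can be exactly 1. \<open>N\<close> is only an upper bound for the norm, hence may be positive
  even if \<open>y\<close> vanishes.\<close>

lemma Lp_norm_one_plus_centered_le:
  assumes q: "2 \<le> q"
  defines "k \<equiv> 1 + 3 * (q\<^sup>2 + (q + 1) powr q)"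
  assumes y: "y \<in> Lp_space M q" "y \<in> L2 M" and mean: "expectation y = 0"
    and N: "0 < N" "(\<integral>x. \<bar>y x\<bar> powr q \<partial>M) \<le> N powr q"
  shows "(\<integral>x. \<bar>1 + y x\<bar> powr q \<partial>M) \<le> (1 + k * N\<^sup>2) powr (q / 2)"
proof -
  define c where "c = q\<^sup>2 + (q + 1) powr q"
  have c: "0 \<le> c" by (simp add: c_def)
  have k: "k = 1 + 3 * c" by (simp add: k_def c_def)
  have int: "integrable M (\<lambda>x. \<bar>y x\<bar> powr q)" "integrable M (\<lambda>x. (y x)\<^sup>2)" "integrable M y"
    using y L2_mult_integrable[OF y(2), of "\<lambda>_. 1"] by (auto simp: Lp_space_def)
  \<comment> \<open>Split at height \<open>N\<close>: below it \<open>N\<^sup>2\<close> is a bound,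
    above it the square of \<open>y / N\<close> is at most its power \<open>q\<close>, since
    \<open>q \<ge> 2\<close>.\<close>
  have "(\<integral>x. (y x)\<^sup>2 \<partial>M) \<le> (\<integral>x. N\<^sup>2 + N\<^sup>2 / N powr q * \<bar>y x\<bar> powr q \<partial>M)"
  proof (rule integral_mono)
    fix x
    show "(y x)\<^sup>2 \<le> N\<^sup>2 + N\<^sup>2 / N powr q * \<bar>y x\<bar> powr q"
    proof (cases "\<bar>y x\<bar> \<le> N")
      case True
      then have "(y x)\<^sup>2 \<le> N\<^sup>2" using power_mono[OF True, of 2] by simp
      then show ?thesis by (simp add: add_increasing2)
    next
      case False
      define z where "z = \<bar>y x\<bar> / N"
      have z: "1 \<le> z" "\<bar>y x\<bar> = N * z" using False N by (auto simp: z_def)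
      have "(y x)\<^sup>2 = \<bar>y x\<bar>\<^sup>2" by simp
      also have "\<dots> = N\<^sup>2 * z powr 2"
        unfolding z(2) using z(1) by (simp add: power_mult_distrib)
      also have "\<dots> \<le> N\<^sup>2 * z powr q" using z q by (intro mult_left_mono powr_mono) auto
      also have "\<dots> = N\<^sup>2 / N powr q * \<bar>y x\<bar> powr q"
        using z N by (simp add: powr_mult)
      finally show ?thesis by (simp add: add_increasing)
    qed
  qed (use int in auto)
  also have "\<dots> = N\<^sup>2 + N\<^sup>2 / N powr q * (\<integral>x. \<bar>y x\<bar> powr q \<partial>M)"
    using int by (simp add: prob_space)
  also have "\<dots> \<le> N\<^sup>2 + N\<^sup>2 / N powr q * N powr q"
    using N by (intro add_left_mono mult_left_mono) auto
  finally have y2: "(\<integral>x. (y x)\<^sup>2 \<partial>M) \<le> 2 * N\<^sup>2" using N by simp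
  have "(\<integral>x. \<bar>1 + y x\<bar> powr q \<partial>M) \<le> (\<integral>x. 1 + q * y x + c * ((y x)\<^sup>2 + \<bar>y x\<bar> powr q) \<partial>M)"
    using int q abs_one_plus_powr_le[of q] Lp_add_const[OF y(1), of 1]
    by (intro integral_mono) (auto simp: c_def)
  also have "\<dots> = 1 + c * ((\<integral>x. (y x)\<^sup>2 \<partial>M) + (\<integral>x. \<bar>y x\<bar> powr q \<partial>M))"
    using int mean by (simp add: prob_space)
  also have "\<dots> \<le> 1 + c * (2 * N\<^sup>2 + N powr q)"
    using c y2 N by (intro add_left_mono mult_left_mono add_mono) auto
  also have "\<dots> \<le> (1 + k * N\<^sup>2) powr (q / 2)"
  \<comment> \<open>For \<open>N \<le> 1\<close> the power \<open>N powr q\<close> is at most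
    \<open>N\<^sup>2\<close>, and the exponent of a base above 1 may be raised to
    \<open>q / 2\<close>. For \<open>N > 1\<close> both 1 and \<open>N\<^sup>2\<close> are at most
    \<open>N powr q\<close>, which leads to the coefficient \<open>1 + 3 * c\<close>.\<close>
  proof (cases "N \<le> 1")
    case True
    have "N powr q \<le> N powr 2" using True N q by (intro powr_mono') auto
    then have "c * N powr q \<le> c * N\<^sup>2" using c N by (intro mult_left_mono) auto
    then have "1 + c * (2 * N\<^sup>2 + N powr q) \<le> 1 + k * N\<^sup>2"
      using zero_le_power2[of N] by (simp add: k algebra_simps add_increasing)
    also have "\<dots> = (1 + k * N\<^sup>2) powr 1" using k c by (simp add: add_nonneg_nonneg)
    also have "\<dots> \<le> (1 + k * N\<^sup>2) powr (q / 2)"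
      using k c q by (intro powr_mono) auto
    finally show ?thesis .
  next
    case False
    have "N powr 2 \<le> N powr q" using False q by (intro powr_mono) auto
    then have N2: "N\<^sup>2 \<le> N powr q" using N by simp
    have "1 \<le> N powr q" using False q by (intro ge_one_powr_ge_zero) auto
    moreover have "c * N\<^sup>2 \<le> c * N powr q" using c N2 by (intro mult_left_mono) auto
    ultimately have "1 + c * (2 * N\<^sup>2 + N powr q) \<le> k * N powr q"
      by (simp add: k algebra_simps)
    also have "\<dots> \<le> k powr (q / 2) * N powr q"
    proof (rule mult_right_mono)
      have "k powr 1 \<le> k powr (q / 2)" using k c q by (intro powr_mono) auto
      then show "k \<le> k powr (q / 2)" using k c by simp
    qed simp
    also have "\<dots> = (k * N\<^sup>2) powr (q / 2)"
    proof -
      have "(N\<^sup>2) powr (q / 2) = N powr q"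
      proof -
        have "N\<^sup>2 = N powr 2" using N by simp
        then show ?thesis by (simp only: powr_powr) simp
      qed
      then show ?thesis using k c N by (simp add: powr_mult)
    qed
    also have "\<dots> \<le> (1 + k * N\<^sup>2) powr (q / 2)"
      using k c q by (intro powr_mono2) auto
    finally show ?thesis .
  qed
  finally show ?thesis .
qed

text \<open>By homogeneity, dividing by \<open>c\<close> reduces this to the constant 1; for
  \<open>c = 0\<close> the bound on \<open>y\<close> suffices as \<open>k \<ge> 1\<close>.\<close>

lemma Lp_norm_const_plus_centered_le:
  assumes q: "2 \<le> q"
  defines "k \<equiv> 1 + 3 * (q\<^sup>2 + (q + 1) powr q)"
  assumes y: "y \<in> Lp_space M q" "y \<in> L2 M" and mean: "expectation y = 0"
    and N: "0 < N" "(\<integral>x. \<bar>y x\<bar> powr q \<partial>M) \<le> N powr q"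
  shows "(\<integral>x. \<bar>c + y x\<bar> powr q \<partial>M) \<le> (c\<^sup>2 + k * N\<^sup>2) powr (q / 2)"
proof -
  have k: "1 \<le> k" by (simp add: k_def)
  have sq: "(a\<^sup>2) powr (q / 2) = \<bar>a\<bar> powr q" for a :: real
  proof -
    have "a\<^sup>2 = \<bar>a\<bar> powr 2" by simp
    then show ?thesis by (simp only: powr_powr) simp
  qed
  show ?thesis
  proof (cases "c = 0")
    case True
    have "(N\<^sup>2) powr (q / 2) \<le> (k * N\<^sup>2) powr (q / 2)"
      using q k mult_right_mono[of 1 k "N\<^sup>2"] by (intro powr_mono2) auto
    then show ?thesis using True N by (simp add: sq)
  next
    case False
    define z where "z = (\<lambda>x. 1 / c * y x)"
    have zq: "\<bar>z x\<bar> powr q = \<bar>y x\<bar> powr q / \<bar>c\<bar> powr q" for x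
      by (simp add: z_def abs_mult powr_divide)
    have "z \<in> Lp_space M q" using y(1) unfolding Lp_space_def by (auto simp: zq) (simp add: z_def)
    moreover have "z \<in> L2 M" unfolding z_def using y(2) by (rule L2_scale)
    moreover have "expectation z = 0" using mean by (simp add: z_def)
    moreover have "0 < N / \<bar>c\<bar>" using N False by simp
    moreover have "(\<integral>x. \<bar>z x\<bar> powr q \<partial>M) \<le> (N / \<bar>c\<bar>) powr q"
      using N False by (simp add: zq powr_divide divide_right_mono)
    ultimately have le: "(\<integral>x. \<bar>1 + z x\<bar> powr q \<partial>M) \<le> (1 + k * (N / \<bar>c\<bar>)\<^sup>2) powr (q / 2)"
      unfolding k_def by (rule Lp_norm_one_plus_centered_le[OF q])
    have "\<bar>c + y x\<bar> powr q = \<bar>c\<bar> powr q * \<bar>1 + z x\<bar> powr q" for x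
    proof -
      have "c + y x = c * (1 + z x)" using False by (simp add: z_def field_simps)
      then show ?thesis by (simp add: abs_mult powr_mult)
    qed
    then have "(\<integral>x. \<bar>c + y x\<bar> powr q \<partial>M) = \<bar>c\<bar> powr q * (\<integral>x. \<bar>1 + z x\<bar> powr q \<partial>M)"
      by simp
    also have "\<dots> \<le> (c\<^sup>2) powr (q / 2) * (1 + k * (N / \<bar>c\<bar>)\<^sup>2) powr (q / 2)"
      unfolding sq using le by (intro mult_left_mono) auto
    also have "\<dots> = (c\<^sup>2 * (1 + k * (N / \<bar>c\<bar>)\<^sup>2)) powr (q / 2)"
      using k by (subst powr_mult) auto
    also have "c\<^sup>2 * (1 + k * (N / \<bar>c\<bar>)\<^sup>2) = c\<^sup>2 + k * N\<^sup>2"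
      using False by (simp add: field_simps)
    finally show ?thesis .
  qed
qed

end

section \<open>From the normalised inequality to the domain of the Dirichlet form\<close>

lemma L2_tendsto_imp_AE_subseq:
  assumes u: "\<And>n. u n \<in> L2 M" and f: "f \<in> L2 M"
    and lim: "(\<lambda>n. Lp_norm M 2 (\<lambda>x. u n x - f x)) \<longlonglongrightarrow> 0"
  obtains r :: "nat \<Rightarrow> nat" where "strict_mono r" "AE x in M. (\<lambda>n. u (r n) x) \<longlonglongrightarrow> f x"
proof -
  have "(\<lambda>n. \<integral>x. norm ((u n x - f x)\<^sup>2) \<partial>M) \<longlonglongrightarrow> 0"
    using tendsto_power[OF lim, of 2]
    by (simp add: Lp_norm_2 L2_inner_self_nonneg) (simp add: L2_inner_def power2_eq_square)
  moreover have "integrable M (\<lambda>x. (u n x - f x)\<^sup>2)" for n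
    using L2_diff[OF u f] by (simp add: L2_iff)
  ultimately obtain r :: "nat \<Rightarrow> nat" where r: "strict_mono r"
    "AE x in M. (\<lambda>n. (u (r n) x - f x)\<^sup>2) \<longlonglongrightarrow> 0"
    using tendsto_L1_AE_subseq[of M "\<lambda>n x. (u n x - f x)\<^sup>2"] by blast
  from r(2) have "AE x in M. (\<lambda>n. u (r n) x) \<longlonglongrightarrow> f x"
  proof eventually_elim
    case (elim x)
    then have "(\<lambda>n. sqrt ((u (r n) x - f x)\<^sup>2)) \<longlonglongrightarrow> sqrt 0"
      by (rule tendsto_real_sqrt)
    then show ?case by (simp add: tendsto_rabs_zero_iff LIM_zero_iff)
  qed
  with r(1) show thesis by (rule that)
qed

context symmetric_Markov_semigroup
begin

lemma approx_form_minus_const: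
  assumes t: "0 < t" and f: "f \<in> L2 M"
  shows "approx_form t (\<lambda>x. f x - c) (\<lambda>x. f x - c) = approx_form t f f"
proof -
  have zero: "approx_form t g (\<lambda>_. c) = 0" if g: "g \<in> L2 M" for g
  proof -
    have "L2_inner M g (P t (\<lambda>_. c)) = L2_inner M g (\<lambda>_. c)"
      using t g P_const[of t c] by (intro L2_inner_cong_AE P_L2 L2_const) auto
    then show ?thesis
      using t g by (simp add: approx_form_def L2_inner_P L2_const)
  qed
  show ?thesis
    using approx_form_diff_self[of t f "\<lambda>_. c"] t f zero[OF f] zero[OF L2_const[of c]]
    by (simp add: L2_const)
qed

text \<open>Apply the normalised inequality to the centred function divided by
  \<open>sqrt W\<close>. Centring leaves the forms unchanged and lets the Poincare inequality bound
  the L^2 part by the energy; the mean is restored by the tightening estimate.\<close>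

lemma generator_domain_Sobolev:
  assumes poin: "Poincare_inequality M P" and A: "0 < A" and q: "2 \<le> q"
    and Sob: "\<And>g. g \<in> L2 M \<Longrightarrow>
      (\<And>t. 0 < t \<Longrightarrow> t \<le> 1 \<Longrightarrow> approx_form t g g + L2_inner M g g \<le> 1) \<Longrightarrow>
      g \<in> Lp_space M q \<and> (\<integral>x. \<bar>g x\<bar> powr q \<partial>M) \<le> A"
  obtains K where "0 \<le> K" "\<And>f e. f \<in> generator_domain M P \<Longrightarrow> 0 < e \<Longrightarrow>
      f \<in> Lp_space M q \<and>
      (\<integral>x. \<bar>f x\<bar> powr q \<partial>M) \<le> ((Lp_norm M 2 f)\<^sup>2 + K * (generator_form M P f + e)) powr (q / 2)"
proof -
  obtain C0 where C0: "\<And>f. f \<in> Dirichlet_domain M P \<Longrightarrow>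
      (\<integral>x. (f x)\<^sup>2 \<partial>M) - (\<integral>x. f x \<partial>M)\<^sup>2 \<le> C0 * Dirichlet_form M P f"
    using poin by (auto simp: Poincare_inequality_def)
  \<comment> \<open>The energy itself contributes 1, the L^2 norm of the centred function
    \<open>\<bar>C0\<bar>\<close>; the Poincare constant carries no sign assumption.\<close>
  define C where "C = \<bar>C0\<bar> + 1"
  define k where "k = 1 + 3 * (q\<^sup>2 + (q + 1) powr q)"
  define K where "K = k * (A powr (1 / q))\<^sup>2 * C"
  have C: "1 \<le> C" by (simp add: C_def)
  have k: "1 \<le> k" by (simp add: k_def)
  have "0 \<le> K" using C k by (simp add: K_def)
  moreover have "f \<in> Lp_space M q \<and> (\<integral>x. \<bar>f x\<bar> powr q \<partial>M)
      \<le> ((Lp_norm M 2 f)\<^sup>2 + K * (generator_form M P f + e)) powr (q / 2)"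
    if fd: "f \<in> generator_domain M P" and e: "0 < e" for f e
  proof -
    define E where "E = generator_form M P f"
    have E: "0 \<le> E" unfolding E_def by (rule generator_form_nonneg[OF fd])
    have f: "f \<in> L2 M" using fd by (rule generator_domain_L2)
    have fint: "integrable M f" "integrable M (\<lambda>x. (f x)\<^sup>2)"
      using f L2_mult_integrable[OF f, of "\<lambda>_. 1"] L2_const[of 1] by (auto simp: L2_iff)
    define c where "c = expectation f"
    define y where "y = (\<lambda>x. f x - c)"
    have y: "y \<in> L2 M" unfolding y_def using f L2_const by (rule L2_diff)
    have mean: "expectation y = 0" using fint by (simp add: y_def c_def prob_space)
    have yy: "L2_inner M y y = (\<integral>x. (f x)\<^sup>2 \<partial>M) - c\<^sup>2"
    proof -
      have "L2_inner M y y = (\<integral>x. (f x)\<^sup>2 - 2 * c * f x + c\<^sup>2 \<partial>M)"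
        by (simp add: L2_inner_def y_def power2_eq_square algebra_simps)
      also have "\<dots> = (\<integral>x. (f x)\<^sup>2 \<partial>M) - c\<^sup>2"
        using fint by (simp add: prob_space c_def power2_eq_square)
      finally show ?thesis .
    qed
    \<comment> \<open>The positive \<open>e\<close> permits the division by \<open>sqrt W\<close>
      even when the energy is zero.\<close>
    define W where "W = C * (E + e)"
    have W: "0 < W" using C E e by (simp add: W_def add_nonneg_pos)
    have bound: "approx_form t y y + L2_inner M y y \<le> W" if t: "0 < t" for t
    proof -
      have "approx_form t y y \<le> E"
        unfolding y_def approx_form_minus_const[OF t f] E_def
        by (rule approx_form_le_generator_form[OF t fd])
      moreover have "L2_inner M y y \<le> \<bar>C0\<bar> * E"
      proof -
        have "L2_inner M y y \<le> C0 * E"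
          using C0[of f] generator_domain_Dirichlet[OF fd] yy by (simp add: c_def E_def)
        also have "\<dots> \<le> \<bar>C0\<bar> * E" using E by (intro mult_right_mono) auto
        finally show ?thesis .
      qed
      moreover have "E + \<bar>C0\<bar> * E \<le> W"
        using C e by (simp add: W_def C_def algebra_simps add_nonneg_nonneg)
      ultimately show ?thesis by linarith
    qed
    define g where "g = (\<lambda>x. 1 / sqrt W * y x)"
    have g: "g \<in> L2 M" unfolding g_def using y by (rule L2_scale)
    have "approx_form t g g + L2_inner M g g \<le> 1" if t: "0 < t" for t
    proof -
      have "approx_form t g g = (1 / sqrt W)\<^sup>2 * approx_form t y y"
        using t y unfolding g_def by (intro approx_form_scale_self) auto
      moreover have "L2_inner M g g = (1 / sqrt W)\<^sup>2 * L2_inner M y y"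
        unfolding g_def by (simp only: L2_inner_scale_left L2_inner_scale_right power2_eq_square mult.assoc)
      ultimately have "approx_form t g g + L2_inner M g g = (approx_form t y y + L2_inner M y y) / W"
        using W by (simp add: power_divide add_divide_distrib)
      then show ?thesis using bound[OF t] W by simp
    qed
    then have gq: "g \<in> Lp_space M q" "(\<integral>x. \<bar>g x\<bar> powr q \<partial>M) \<le> A"
      using Sob[OF g] by auto
    define N where "N = A powr (1 / q) * sqrt W"
    have N: "0 < N" using A W by (simp add: N_def)
    have yg: "\<bar>y x\<bar> powr q = sqrt W powr q * \<bar>g x\<bar> powr q" for x
    proof -
      have "y x = sqrt W * g x" using W by (simp add: g_def)
      then show ?thesis using W by (simp add: abs_mult powr_mult)
    qed
    have yq: "y \<in> Lp_space M q"
      using gq(1) L2_measurable[OF y] by (simp add: Lp_space_def yg)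
    have "(\<integral>x. \<bar>y x\<bar> powr q \<partial>M) = sqrt W powr q * (\<integral>x. \<bar>g x\<bar> powr q \<partial>M)"
      by (simp add: yg)
    also have "\<dots> \<le> sqrt W powr q * A" using gq(2) by (intro mult_left_mono) auto
    also have "\<dots> = N powr q"
      using A W q by (simp add: N_def powr_mult powr_powr)
    finally have yN: "(\<integral>x. \<bar>y x\<bar> powr q \<partial>M) \<le> N powr q" .
    have cf: "(\<lambda>x. \<bar>c + y x\<bar> powr q) = (\<lambda>x. \<bar>f x\<bar> powr q)" by (simp add: y_def)
    have "f \<in> Lp_space M q"
      using Lp_add_const[OF yq, of c] q L2_measurable[OF f] unfolding cf by (simp add: Lp_space_def)
    moreover have "(\<integral>x. \<bar>f x\<bar> powr q \<partial>M) \<le> (c\<^sup>2 + k * N\<^sup>2) powr (q / 2)"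
      using Lp_norm_const_plus_centered_le[OF q yq y mean N yN, of c] unfolding cf k_def .
    moreover have "(c\<^sup>2 + k * N\<^sup>2) powr (q / 2)
        \<le> ((Lp_norm M 2 f)\<^sup>2 + K * (generator_form M P f + e)) powr (q / 2)"
    proof (rule powr_mono2)
      have "k * N\<^sup>2 = K * (generator_form M P f + e)"
        using W by (simp add: N_def power_mult_distrib K_def W_def E_def)
      moreover have "c\<^sup>2 \<le> (Lp_norm M 2 f)\<^sup>2"
        using yy L2_inner_self_nonneg[of M y]
        by (simp add: Lp_norm_2 L2_inner_self_nonneg) (simp add: L2_inner_def power2_eq_square)
      ultimately show "c\<^sup>2 + k * N\<^sup>2 \<le> (Lp_norm M 2 f)\<^sup>2 + K * (generator_form M P f + e)" by simp
      show "0 \<le> c\<^sup>2 + k * N\<^sup>2" using k by simp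
    qed (use q in simp)
    ultimately show ?thesis by linarith
  qed
  ultimately show thesis by (rule that)
qed

text \<open>Along an approximating sequence the right-hand sides converge, and Fatou's lemma along
  an almost everywhere convergent subsequence keeps the left-hand side; finally \<open>e\<close>
  tends to 0.\<close>

lemma Dirichlet_domain_Sobolev:
  assumes K: "0 \<le> K" and q: "0 < q" and Sob: "\<And>f e. f \<in> generator_domain M P \<Longrightarrow> 0 < e \<Longrightarrow>
      f \<in> Lp_space M q \<and>
      (\<integral>x. \<bar>f x\<bar> powr q \<partial>M) \<le> ((Lp_norm M 2 f)\<^sup>2 + K * (generator_form M P f + e)) powr (q / 2)"
    and fd: "f \<in> Dirichlet_domain M P"
  shows "f \<in> Lp_space M q"
    and "(Lp_norm M q f)\<^sup>2 \<le> (Lp_norm M 2 f)\<^sup>2 + K * Dirichlet_form M P f"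
proof -
  obtain u where f: "f \<in> L2 M" and u: "form_approximates M P u f"
    using fd by (auto simp: Dirichlet_domain_def)
  have ud: "u n \<in> generator_domain M P" for n using u by (simp add: form_approximates_def)
  have uL: "u n \<in> L2 M" for n using ud by (rule generator_domain_L2)
  have lim: "(\<lambda>n. Lp_norm M 2 (\<lambda>x. u n x - f x)) \<longlonglongrightarrow> 0"
    using u by (simp add: form_approximates_def)
  obtain r :: "nat \<Rightarrow> nat" where r: "strict_mono r" "AE x in M. (\<lambda>n. u (r n) x) \<longlonglongrightarrow> f x"
    using L2_tendsto_imp_AE_subseq[OF uL f lim] by blast
  \<comment> \<open>The last summand \<open>e\<close> leaves room above the limit, so that the bound
    holds from some index on.\<close>
  define B where "B e = (Lp_norm M 2 f)\<^sup>2 + K * (Dirichlet_form M P f + e) + e" for e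
  have B: "0 \<le> B e \<and> f \<in> Lp_space M q \<and> (\<integral>x. \<bar>f x\<bar> powr q \<partial>M) \<le> B e powr (q / 2)"
    if e: "0 < e" for e
  proof -
    have "(\<lambda>n. (Lp_norm M 2 (u n))\<^sup>2 + K * (generator_form M P (u n) + e))
        \<longlonglongrightarrow> (Lp_norm M 2 f)\<^sup>2 + K * (Dirichlet_form M P f + e)"
      by (intro tendsto_intros Lp_norm_2_tendsto[OF uL f lim] Dirichlet_form_tendsto[OF f u])
    then have "\<forall>\<^sub>F n in sequentially. (Lp_norm M 2 (u n))\<^sup>2 + K * (generator_form M P (u n) + e) < B e"
      using e by (intro order_tendstoD(2)) (auto simp: B_def)
    then obtain n0 where n0: "\<And>n. n0 \<le> n \<Longrightarrow>
        (Lp_norm M 2 (u n))\<^sup>2 + K * (generator_form M P (u n) + e) < B e"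
      by (auto simp: eventually_sequentially)
    have nn: "0 \<le> (Lp_norm M 2 (u n))\<^sup>2 + K * (generator_form M P (u n) + e)" for n
      using K e generator_form_nonneg[OF ud[of n]] by simp
    have "0 \<le> B e" using nn[of n0] n0[of n0] by simp
    \<comment> \<open>The shift drops the initial terms: \<open>r\<close> is strictly increasing, so
      every index used is at least \<open>n0\<close>.\<close>
    define v where "v n = u (r (n + n0))" for n
    have "n0 \<le> r (n + n0)" for n using seq_suble[OF r(1), of "n + n0"] by simp
    then have bd: "(\<integral>x. \<bar>v n x\<bar> powr q \<partial>M) \<le> B e powr (q / 2)" for n
      using Sob[OF ud e, of "r (n + n0)"] n0[of "r (n + n0)"] nn[of "r (n + n0)"] q
        powr_mono2[of "q / 2" "(Lp_norm M 2 (v n))\<^sup>2 + K * (generator_form M P (v n) + e)" "B e"]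
      unfolding v_def by fastforce
    have int: "integrable M (\<lambda>x. \<bar>v n x\<bar> powr q)" for n
      using Sob[OF ud e] by (simp add: v_def Lp_space_def)
    have conv: "AE x in M. (\<lambda>n. v n x) \<longlonglongrightarrow> f x"
      using r(2) unfolding v_def by eventually_elim (rule LIMSEQ_ignore_initial_segment)
    have meas: "v n \<in> borel_measurable M" for n
      unfolding v_def using uL by (rule L2_measurable)
    show ?thesis
      using Lp_space_bound_liminf[OF L2_measurable[OF f] meas conv q _ int bd] \<open>0 \<le> B e\<close> by simp
  qed
  show "f \<in> Lp_space M q" using B[of 1] by simp
  have le: "(Lp_norm M q f)\<^sup>2 \<le> B e" if e: "0 < e" for e
  proof -
    have "(Lp_norm M q f)\<^sup>2 = (\<integral>x. \<bar>f x\<bar> powr q \<partial>M) powr (2 / q)"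
      by (simp add: Lp_norm_def power2_eq_square flip: powr_add)
    also have "\<dots> \<le> (B e powr (q / 2)) powr (2 / q)"
      using B[OF e] q by (intro powr_mono2) auto
    also have "\<dots> = B e" using B[OF e] q by (simp add: powr_powr)
    finally show ?thesis .
  qed
  have "(B \<longlongrightarrow> (Lp_norm M 2 f)\<^sup>2 + K * (Dirichlet_form M P f + 0) + 0) (at_right 0)"
    unfolding B_def by (intro tendsto_intros)
  then show "(Lp_norm M q f)\<^sup>2 \<le> (Lp_norm M 2 f)\<^sup>2 + K * Dirichlet_form M P f"
    using le by (intro tendsto_lowerbound[of B]) (auto intro!: eventually_at_right_less[THEN eventually_mono])
qed

end

theorem theorem5p4:
  fixes M :: "'a measure"
    and P :: "real \<Rightarrow> ('a \<Rightarrow> real) \<Rightarrow> 'a \<Rightarrow> real"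
    and H :: "nat \<Rightarrow> ('a \<Rightarrow> real) set"
    and a C p :: real
  assumes "symmetric_Markov_semigroup M P"
    and "Poincare_inequality M P"
    and "orthogonal_decomposition M H"
    and "H 0 = constant_functions M"
    and "a > 0" and "C > 0" and "p > 1 / 2"
    and "\<And>k f t. k \<ge> 1 \<Longrightarrow> f \<in> H k \<Longrightarrow> t > 0 \<Longrightarrow>
      Linf_norm M (P t f) \<le> ereal (C * real k powr p * exp (- a * t * (real k)\<^sup>2) * Lp_norm M 2 f)"
  shows "tight_Sobolev_inequality M P (2 * p + 1)"
proof -
  interpret symmetric_Markov_semigroup M P by (rule assms(1))
  \<comment> \<open>\<open>r\<close> is half the dimension \<open>2 * p + 1\<close>, so
    \<open>p > 1 / 2\<close> means \<open>r > 1\<close>, and \<open>q\<close> becomes the Sobolev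
    exponent of that dimension.\<close>
  define r where "r = p + 1 / 2"
  define q where "q = 2 * r / (r - 1)"
  have r: "1 < r" using assms(7) by (simp add: r_def)
  have q: "2 \<le> q" using r by (simp add: q_def field_simps)
  have q_eq: "2 * (2 * p + 1) / ((2 * p + 1) - 2) = q"
    using assms(7) by (simp add: q_def r_def field_simps)
  have p: "0 < p" using assms(7) by simp
  obtain K0 where K0: "0 < K0" "\<And>t g. 0 < t \<Longrightarrow> t \<le> 1 \<Longrightarrow> g \<in> L2 M \<Longrightarrow>
      L2_inner M (P t g) (P t g) \<le> K0 * t powr (- r) * (\<integral>x. \<bar>g x\<bar> \<partial>M)\<^sup>2"
    using ultracontractive[OF assms(3-6) p assms(8)] unfolding r_def by blast
  obtain A where A: "0 < A" "\<And>g. g \<in> L2 M \<Longrightarrow>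
      (\<And>t. 0 < t \<Longrightarrow> t \<le> 1 \<Longrightarrow> approx_form t g g + L2_inner M g g \<le> 1) \<Longrightarrow>
      g \<in> Lp_space M q \<and> (\<integral>x. \<bar>g x\<bar> powr q \<partial>M) \<le> A"
    using Sobolev_normalized[OF K0(2,1) r] unfolding q_def by blast
  obtain K where K: "0 \<le> K" "\<And>f e. f \<in> generator_domain M P \<Longrightarrow> 0 < e \<Longrightarrow>
      f \<in> Lp_space M q \<and>
      (\<integral>x. \<bar>f x\<bar> powr q \<partial>M) \<le> ((Lp_norm M 2 f)\<^sup>2 + K * (generator_form M P f + e)) powr (q / 2)"
    using generator_domain_Sobolev[OF assms(2) A(1) q A(2)] by blast
  have "0 < q" using q by simp
  then show ?thesis
    unfolding tight_Sobolev_inequality_def q_eq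
    using Dirichlet_domain_Sobolev[OF K(1) _ K(2)] by blast
qed

end
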